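(* Let $\emptyset\neq\mathcal{A}\subseteq\mathbb{R}^n$ and $\mathcal{B}\subseteq\mathbb{N}^n\setminus(2\mathbb{N})^n$ be finite sets and let $(v,w)\in\mathbb{R}^{\mathcal{A}}\times\mathbb{R}^{\mathcal{B}}$. (1) If $(v,w)\in C_{\mathcal{S}}(\mathcal{A},\mathcal{B})^*$, then $v_\alpha\ge0$ for all $\alpha\in\mathcal{A}$. (2) If $v_\alpha\ge0$ for all $\alpha\in\mathcal{A}$, then the following are equivalent: (a) $(v,w)$ lies in the dual cone $C_{\mathcal{S}}(\mathcal{A},\mathcal{B})^*$. (b) For all $\beta\in\mathcal{A}$ and all $\lambda\in\Lambda(\mathcal{A},\beta)$ it holds that $\ln|v_\beta|\le\sum_{\alpha\in\mathcal{A}}\lambda_\alpha\ln(v_\alpha)$, and for all $\beta\in\mathcal{B}$ and all $\lambda\in\Lambda(\mathcal{A},\beta)$ it holds that $\ln|w_\beta|\le\sum_{\alpha\in\mathcal{A}}\lambda_\alpha\ln(v_\alpha)$. (c) For every even circuit $(A,\beta)\in I(\mathcal{A},\mathcal{A})$ and $\lambda=\lambda(A,\beta)$ it holds that $\ln|v_\beta|\le\sum_{\alpha\in A}\lambda_\alpha\ln(v_\alpha)$, and for every odd circuit $(A,\beta)\in I(\mathcal{A},\mathcal{B})$ and $\lambda=\lambda(A,\beta)$ it holds that $\ln|w_\beta|\le\sum_{\alpha\in A}\lambda_\alpha\ln(v_\alpha)$. (d) For every reduced even circuit $(A,\beta)\in I(\mathcal{A},\mathcal{A})$ and $\lambda=\lambda(A,\beta)$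 it holds that $\ln|v_\beta|\le\sum_{\alpha\in A}\lambda_\alpha\ln(v_\alpha)$, and for every reduced odd circuit $(A,\beta)\in I(\mathcal{A},\mathcal{B})$ and $\lambda=\lambda(A,\beta)$ it holds that $\ln|w_\beta|\le\sum_{\alpha\in A}\lambda_\alpha\ln(v_\alpha)$.
   Context: $\mathbb{N}=\{0,1,2,\ldots\}$, $\mathbb{R}_+=[0,\infty)$. Conventions: $0\ln(0)=0$ and $\ln(0)=-\infty$. For $x\in\mathbb{R}^n$, $\alpha\in\mathbb{R}^n$, $\beta\in\mathbb{N}^n$ put $|x|^\alpha=\prod_j|x_j|^{\alpha_j}$ and $x^\beta=\prod_j x_j^{\beta_j}$; if a component of $x$ is zero and the corresponding exponent is negative, then $|x|^\alpha=\infty$. For finite sets $\emptyset\neq\mathcal{A}\subseteq\mathbb{R}^n$ and $\mathcal{B}\subseteq\mathbb{N}^n\setminus(2\mathbb{N})^n$ (not necessarily disjoint), $\mathbb{R}[\mathcal{A},\mathcal{B}]$ is the real vector space, of dimension $|\mathcal{A}|+|\mathcal{B}|$, of all functions $f=\sum_{\alpha\in\mathcal{A}}c_\alpha|x|^\alpha+\sum_{\beta\in\mathcal{B}}d_\beta x^\beta$ with real coefficients. Such an $f$ is viewed as a function $\mathbb{R}^n\to\mathbb{R}\cup\{\infty\}$, with value $\infty$ at points where some monomial occurring in $f$ with nonzero coefficient is $\infty$; $f$ is non-negative if $f(x)\ge0$ for all $x\in\mathbb{R}^n$. Such an $f$ is an even AG function if at most one $c_\alpha$ is negative and all $d_\beta$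 are zero; it is an odd AG function if all $c_\alpha$ are non-negative and at most one $d_\beta$ is nonzero; it is an AG function if it is an even or an odd AG function. The $\mathcal{S}$-cone $C_{\mathcal{S}}(\mathcal{A},\mathcal{B})$ is the conic hull (set of all finite non-negative linear combinations, including $0$) of the non-negative AG functions in $\mathbb{R}[\mathcal{A},\mathcal{B}]$. For $(v,w)\in\mathbb{R}^{\mathcal{A}}\times\mathbb{R}^{\mathcal{B}}$ and $f$ with coefficients $(c_\alpha),(d_\beta)$, put $(v,w)(f)=\sum_{\alpha\in\mathcal{A}}v_\alpha c_\alpha+\sum_{\beta\in\mathcal{B}}w_\beta d_\beta$. The dual cone is $C_{\mathcal{S}}(\mathcal{A},\mathcal{B})^*=\{(v,w)\in\mathbb{R}^{\mathcal{A}}\times\mathbb{R}^{\mathcal{B}} : (v,w)(f)\ge0\text{ for all }f\in C_{\mathcal{S}}(\mathcal{A},\mathcal{B})\}$. For a non-empty finite set $A\subseteq\mathbb{R}^n$ and $\beta\in\mathbb{R}^n$, $\Lambda(A,\beta)=\{\lambda\in\mathbb{R}_+^{A}:\sum_{\alpha\in A}\lambda_\alpha\alpha=\beta,\ \sum_{\alpha\in A}\lambda_\alpha=1\}$. A circuit is a pair $(A,\beta)$ with $A\subseteq\mathbb{R}^n$ affinely independent and $\beta\in\operatorname{relint}\operatorname{conv}(A)$ (singletons $A=\{\beta\}$ are allowed); then $\Lambda(A,\beta)$ has exactly one element, denoted $\lambda(A,\beta)$. $I(\mathcal{A},\mathcal{A})$ is the set of circuits $(A,\beta)$ with $A\subseteq\mathcal{A}$,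 $\beta\in\mathcal{A}$ (even circuits), and $I(\mathcal{A},\mathcal{B})$ is the set of circuits $(A,\beta)$ with $A\subseteq\mathcal{A}$, $\beta\in\mathcal{B}$ (odd circuits). An even circuit is reduced if $(\operatorname{conv}(A)\setminus(A\cup\{\beta\}))\cap\mathcal{A}=\emptyset$; an odd circuit is reduced if $(\operatorname{conv}(A)\setminus A)\cap\mathcal{A}=\emptyset$. *)

theory Defs
  imports "HOL-Analysis.Analysis" "HOL-Analysis.Finite_Function_Topology"
begin

text \<open>
  A function \<open>f = \<Sum>\<^sub>\<alpha> c\<^sub>\<alpha> |x|\<^sup>\<alpha> + \<Sum>\<^sub>\<beta> d\<^sub>\<beta> x\<^sup>\<beta>\<close> is represented by its pair \<open>(c, d)\<close> of finitely
  supported coefficient families.  Since no \<open>\<beta>\<close> lies in \<open>(2\<nat>)\<^sup>n\<close>, the monomials are linearly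
  independent, so the pair is determined by the function.  An even and an odd exponent may denote
  the same point of \<open>\<real>\<^sup>n\<close>; they have different types here, so the two coefficients stay apart.
\<close>

type_synonym 'n ag_fun = "((real^'n) \<Rightarrow>\<^sub>0 real) \<times> ((nat^'n) \<Rightarrow>\<^sub>0 real)"

definition real_vec :: "nat^'n \<Rightarrow> real^'n" where
  "real_vec \<beta> = (\<chi> j. real (\<beta> $ j))"

text \<open>The case \<open>\<alpha>\<^sub>j = 0\<close> is separate because \<open>0 powr 0 = 0\<close> in the library, whereas \<open>|0|\<^sup>0 = 1\<close> here.\<close>

definition abs_monomial :: "real^'n::finite \<Rightarrow> real^'n \<Rightarrow> ereal" where
  "abs_monomial \<alpha> x =
     (if \<exists>j. x $ j = 0 \<and> \<alpha> $ j < 0 then \<infinity>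
      else ereal (\<Prod>j\<in>UNIV. if \<alpha> $ j = 0 then 1 else \<bar>x $ j\<bar> powr (\<alpha> $ j)))"

definition monomial :: "nat^'n::finite \<Rightarrow> real^'n \<Rightarrow> real" where
  "monomial \<beta> x = (\<Prod>j\<in>UNIV. (x $ j) ^ (\<beta> $ j))"

definition ag_eval :: "'n::finite ag_fun \<Rightarrow> real^'n \<Rightarrow> ereal" where
  "ag_eval f x =
     (if \<exists>\<alpha>\<in>Poly_Mapping.keys (fst f). abs_monomial \<alpha> x = \<infinity> then \<infinity>
      else (\<Sum>\<alpha>\<in>Poly_Mapping.keys (fst f). ereal (Poly_Mapping.lookup (fst f) \<alpha>) * abs_monomial \<alpha> x)
         + ereal (\<Sum>\<beta>\<in>Poly_Mapping.keys (snd f). Poly_Mapping.lookup (snd f) \<beta> * monomial \<beta> x))"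

definition nonneg_fun :: "'n::finite ag_fun \<Rightarrow> bool" where
  "nonneg_fun f \<longleftrightarrow> (\<forall>x. 0 \<le> ag_eval f x)"

definition fun_space :: "(real^'n) set \<Rightarrow> (nat^'n) set \<Rightarrow> 'n ag_fun set" where
  "fun_space \<A> \<B> = {f. Poly_Mapping.keys (fst f) \<subseteq> \<A> \<and> Poly_Mapping.keys (snd f) \<subseteq> \<B>}"

definition even_AG :: "'n ag_fun \<Rightarrow> bool" where
  "even_AG f \<longleftrightarrow> card {\<alpha>. Poly_Mapping.lookup (fst f) \<alpha> < 0} \<le> 1 \<and> snd f = 0"

definition odd_AG :: "'n ag_fun \<Rightarrow> bool" where
  "odd_AG f \<longleftrightarrow> (\<forall>\<alpha>. 0 \<le> Poly_Mapping.lookup (fst f) \<alpha>) \<and> card (Poly_Mapping.keys (snd f)) \<le> 1"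

text \<open>The library's \<open>conic hull\<close> is closed only under scaling; finite non-negative combinations are
  given by \<open>convex_cone hull\<close> (see \<open>convex_cone_hull_finite_combinations\<close> below).\<close>

definition S_cone :: "(real^'n::finite) set \<Rightarrow> (nat^'n) set \<Rightarrow> 'n ag_fun set" where
  "S_cone \<A> \<B> = convex_cone hull {f \<in> fun_space \<A> \<B>. (even_AG f \<or> odd_AG f) \<and> nonneg_fun f}"

lemma convex_cone_hull_finite_combinations:
  fixes S :: "'a::real_vector set"
  shows "convex_cone hull S =
    {\<Sum>g\<in>G. t g *\<^sub>R g | G t. finite G \<and> G \<subseteq> S \<and> (\<forall>g\<in>G. 0 \<le> t g)}" (is "_ = ?R")
proof
  show "convex_cone hull S \<subseteq> ?R"
  proof (rule hull_minimal)
    show "S \<subseteq> ?R"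
    proof
      fix x assume "x \<in> S"
      then have "x = (\<Sum>g\<in>{x}. 1 *\<^sub>R g) \<and> finite {x} \<and> {x} \<subseteq> S \<and> (\<forall>g\<in>{x}. (0::real) \<le> 1)"
        by simp
      then show "x \<in> ?R" by (intro CollectI exI[of _ "{x}"] exI[of _ "\<lambda>_. 1"])
    qed
    have add: "x + y \<in> ?R" if xy: "x \<in> ?R" "y \<in> ?R" for x y
    proof -
      from xy(1) obtain G s where G: "x = (\<Sum>g\<in>G. s g *\<^sub>R g)" "finite G" "G \<subseteq> S" "\<forall>g\<in>G. 0 \<le> s g"
        by blast
      from xy(2) obtain H t where H: "y = (\<Sum>g\<in>H. t g *\<^sub>R g)" "finite H" "H \<subseteq> S" "\<forall>g\<in>H. 0 \<le> t g"
        by blast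
      define u where "u g = (if g \<in> G then s g else 0) + (if g \<in> H then t g else 0)" for g
      have "(\<Sum>g\<in>G \<union> H. u g *\<^sub>R g) =
          (\<Sum>g\<in>G \<union> H. if g \<in> G then s g *\<^sub>R g else 0) + (\<Sum>g\<in>G \<union> H. if g \<in> H then t g *\<^sub>R g else 0)"
        unfolding sum.distrib[symmetric] by (rule sum.cong) (auto simp: u_def scaleR_left_distrib)
      also have "\<dots> = x + y"
      proof (rule arg_cong2[of _ _ _ _ "(+)"])
        show "(\<Sum>g\<in>G \<union> H. if g \<in> G then s g *\<^sub>R g else 0) = x"
          unfolding G(1) by (rule sum.mono_neutral_cong_right) (use G(2) H(2) in auto)
        show "(\<Sum>g\<in>G \<union> H. if g \<in> H then t g *\<^sub>R g else 0) = y"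
          unfolding H(1) by (rule sum.mono_neutral_cong_right) (use G(2) H(2) in auto)
      qed
      finally have "x + y = (\<Sum>g\<in>G \<union> H. u g *\<^sub>R g)" by simp
      moreover have "finite (G \<union> H)" "G \<union> H \<subseteq> S" "\<forall>g\<in>G \<union> H. 0 \<le> u g"
        using G H by (auto simp: u_def)
      ultimately show ?thesis by blast
    qed
    have scale: "c *\<^sub>R x \<in> ?R" if x: "x \<in> ?R" "0 \<le> c" for x c
    proof -
      from x(1) obtain G s where G: "x = (\<Sum>g\<in>G. s g *\<^sub>R g)" "finite G" "G \<subseteq> S" "\<forall>g\<in>G. 0 \<le> s g"
        by blast
      have "c *\<^sub>R x = (\<Sum>g\<in>G. (c * s g) *\<^sub>R g)" by (simp add: G(1) scaleR_sum_right)
      moreover have "\<forall>g\<in>G. 0 \<le> c * s g" using G(4) x(2) by simp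
      ultimately show ?thesis using G(2,3)
        by (intro CollectI exI[of _ G] exI[of _ "\<lambda>g. c * s g"]) simp
    qed
    have "0 \<in> ?R" by (intro CollectI exI[of _ "{}"]) simp
    then show "convex_cone ?R"
      unfolding convex_cone_iff by (intro conjI ballI allI impI add scale \<open>0 \<in> ?R\<close>)
  qed
  show "?R \<subseteq> convex_cone hull S"
  proof
    fix x assume "x \<in> ?R"
    then obtain G s where G: "x = (\<Sum>g\<in>G. s g *\<^sub>R g)" "finite G" "G \<subseteq> S" "\<forall>g\<in>G. 0 \<le> s g"
      by blast
    have "(\<Sum>g\<in>G. s g *\<^sub>R g) \<in> convex_cone hull S"
      using G(2-4)
    proof (induction G)
      case empty
      then show ?case by (simp add: convex_cone_hull_contains_0)
    next
      case (insert a G)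
      have "s a *\<^sub>R a \<in> convex_cone hull S"
        by (rule convex_cone_scaleR[OF convex_cone_convex_cone_hull]) (use insert.prems in \<open>auto intro: hull_inc\<close>)
      then show ?case
        using insert by (simp add: convex_cone_add[OF convex_cone_convex_cone_hull])
    qed
    then show "x \<in> convex_cone hull S" using G(1) by simp
  qed
qed

text \<open>\<open>\<real>\<^sup>S\<close> is rendered as \<open>S \<rightarrow>\<^sub>E UNIV\<close>, i.e. functions with a fixed dummy value outside \<open>S\<close>;
  this makes the weights of a circuit unique as functions.\<close>

definition pairing ::
  "(real^'n) set \<Rightarrow> (nat^'n) set \<Rightarrow> (real^'n \<Rightarrow> real) \<times> (nat^'n \<Rightarrow> real) \<Rightarrow> 'n ag_fun \<Rightarrow> real" where
  "pairing \<A> \<B> = (\<lambda>(v, w) (c, d).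
     (\<Sum>\<alpha>\<in>\<A>. v \<alpha> * Poly_Mapping.lookup c \<alpha>) + (\<Sum>\<beta>\<in>\<B>. w \<beta> * Poly_Mapping.lookup d \<beta>))"

definition dual_S_cone ::
  "(real^'n::finite) set \<Rightarrow> (nat^'n) set \<Rightarrow> ((real^'n \<Rightarrow> real) \<times> (nat^'n \<Rightarrow> real)) set" where
  "dual_S_cone \<A> \<B> =
     {vw \<in> (\<A> \<rightarrow>\<^sub>E UNIV) \<times> (\<B> \<rightarrow>\<^sub>E UNIV). \<forall>f\<in>S_cone \<A> \<B>. 0 \<le> pairing \<A> \<B> vw f}"

definition Lam :: "(real^'n) set \<Rightarrow> real^'n \<Rightarrow> (real^'n \<Rightarrow> real) set" where
  "Lam A \<beta> = {l \<in> A \<rightarrow>\<^sub>E {0..}. (\<Sum>\<alpha>\<in>A. l \<alpha> *\<^sub>R \<alpha>) = \<beta> \<and> (\<Sum>\<alpha>\<in>A. l \<alpha>) = 1}"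

definition circuit :: "(real^'n::finite) set \<Rightarrow> real^'n \<Rightarrow> bool" where
  "circuit A \<beta> \<longleftrightarrow> \<not> affine_dependent A \<and> \<beta> \<in> rel_interior (convex hull A)"

definition circuit_lam :: "(real^'n) set \<Rightarrow> real^'n \<Rightarrow> real^'n \<Rightarrow> real" where
  "circuit_lam A \<beta> = (THE l. l \<in> Lam A \<beta>)"

lemma circuit_lam_unique:
  assumes "circuit A \<beta>"
  shows "\<exists>!l. l \<in> Lam A \<beta>"
proof -
  from assms have ind: "\<not> affine_dependent A" and "\<beta> \<in> rel_interior (convex hull A)"
    by (auto simp: circuit_def)
  then have b: "\<beta> \<in> convex hull A" using rel_interior_subset by blast
  have fin: "finite A" using ind by (rule aff_independent_finite)
  from b obtain u where u: "\<forall>x\<in>A. 0 \<le> u x" "sum u A = 1" "(\<Sum>x\<in>A. u x *\<^sub>R x) = \<beta>"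
    unfolding convex_hull_finite[OF fin] by blast
  have ex: "restrict u A \<in> Lam A \<beta>"
    using u by (auto simp: Lam_def)
  have eq: "l = m" if "l \<in> Lam A \<beta>" "m \<in> Lam A \<beta>" for l m
  proof (rule ccontr)
    assume "l \<noteq> m"
    have lm: "l \<in> extensional A" "m \<in> extensional A" using that by (auto simp: Lam_def PiE_def)
    have "\<exists>x\<in>A. l x \<noteq> m x"
      using \<open>l \<noteq> m\<close> extensionalityI[OF lm] by blast
    moreover have "(\<Sum>x\<in>A. l x - m x) = 0" "(\<Sum>x\<in>A. (l x - m x) *\<^sub>R x) = 0"
      using that by (simp_all add: Lam_def sum_subtractf scaleR_left_diff_distrib)
    ultimately have "affine_dependent A"
      unfolding affine_dependent_explicit_finite[OF fin]
      by (intro exI[of _ "\<lambda>x. l x - m x"]) auto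
    then show False using ind by simp
  qed
  show ?thesis using ex eq by blast
qed

definition even_circuits :: "(real^'n::finite) set \<Rightarrow> ((real^'n) set \<times> (real^'n)) set" where
  "even_circuits \<A> = {(A, \<beta>). A \<subseteq> \<A> \<and> \<beta> \<in> \<A> \<and> circuit A \<beta>}"

definition odd_circuits ::
  "(real^'n::finite) set \<Rightarrow> (nat^'n) set \<Rightarrow> ((real^'n) set \<times> (nat^'n)) set" where
  "odd_circuits \<A> \<B> = {(A, \<beta>). A \<subseteq> \<A> \<and> \<beta> \<in> \<B> \<and> circuit A (real_vec \<beta>)}"

definition reduced_even_circuits :: "(real^'n::finite) set \<Rightarrow> ((real^'n) set \<times> (real^'n)) set" where
  "reduced_even_circuits \<A> =
     {(A, \<beta>) \<in> even_circuits \<A>. (convex hull A - (A \<union> {\<beta>})) \<inter> \<A> = {}}"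

definition reduced_odd_circuits ::
  "(real^'n::finite) set \<Rightarrow> (nat^'n) set \<Rightarrow> ((real^'n) set \<times> (nat^'n)) set" where
  "reduced_odd_circuits \<A> \<B> =
     {(A, \<beta>) \<in> odd_circuits \<A> \<B>. (convex hull A - A) \<inter> \<A> = {}}"

text \<open>Only used for non-negative arguments.  In \<open>ereal\<close>, \<open>0 * (-\<infinity>) = 0\<close>, which is the
  convention \<open>0 ln 0 = 0\<close> when a zero weight meets a zero value.\<close>

definition eln :: "real \<Rightarrow> ereal" where
  "eln t = (if t = 0 then -\<infinity> else ereal (ln t))"

end

theory Submission
  imports Defs
begin

text \<open>
Write \<open>h = ln v\<close> for positive \<open>v\<close>.  Then (b) bounds \<open>h \<beta>\<close>, or \<open>ln \<bar>w\<^sub>\<beta>\<bar>\<close>, by a linear functional on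
the polytope of all convex representations of \<open>\<beta>\<close> by points of \<open>\<A>\<close>; (c) is the same bound at the
vertices of the polytope, which are the circuits; (d) keeps only some vertices.

(d) implies (b).  Shrinking the support of a representation along affine dependences reaches a
circuit without increasing the functional (\<open>circuit_below_weights\<close>).  Suppose an even circuit
\<open>(A, b\<^sub>0)\<close> violates its inequality.  Subtract from \<open>h\<close> the affine function that agrees with \<open>h\<close> on
\<open>A\<close>, take the points of \<open>\<A> \<inter> conv A\<close> where the difference is maximal, and among them a point \<open>b\<close> of
largest norm.  No representation of \<open>b\<close> by other points of \<open>\<A> \<inter> conv A\<close> can satisfy the inequality:
all its points would have the maximal difference, and by strict convexity of the squared norm one of
them would be longer than \<open>b\<close>.  But one of these representations is a reduced circuit, namely the
circuit with the smallest weighted sum of squared norms (\<open>reduced_circuit_exists\<close>).  For an odd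
circuit, pass to a reduced circuit inside \<open>conv A\<close> and use the even inequalities to compare the two
sums.

(a) implies (b).  By the weighted arithmetic-geometric mean inequality,
\<open>\<Sum> \<lambda>\<^sub>\<alpha> c\<^sub>\<alpha> |x|\<^sup>\<alpha> \<ge> \<Prod> c\<^sub>\<alpha>\<^sup>\<lambda> |x|\<^sup>\<beta>\<close>.  The difference is a non-negative AG function, and pairing it
with \<open>(v, w)\<close> for \<open>c\<^sub>\<alpha> = 1 / v\<^sub>\<alpha>\<close> gives (b).

(b) implies (a).  By linear programming duality (\<open>separating_affine_function\<close>) there is, up to an
arbitrarily small loss, an affine function \<open>\<alpha> \<mapsto> y \<bullet> \<alpha> + k\<close> that lies below \<open>ln v\<close> on \<open>\<A>\<close> and above
\<open>ln v\<^sub>\<beta>\<close> or \<open>ln \<bar>w\<^sub>\<beta>\<bar>\<close> at \<open>\<beta>\<close>.  Non-negativity of an AG function at the single point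
\<open>x = exp y\<close>, with suitable signs, then bounds its pairing with \<open>(v, w)\<close> from below.

Zeros of \<open>v\<close> are handled by replacing \<open>v\<close> with \<open>max v \<epsilon>\<close>.  Each of the inequalities holds for \<open>v\<close>
if and only if it holds for all these truncations: from right to left let \<open>\<epsilon>\<close> tend to \<open>0\<close>, and from left
to right use that truncation increases the sum and that the weighted geometric mean of numbers
\<open>\<ge> \<epsilon>\<close> is \<open>\<ge> \<epsilon>\<close> (\<open>eln_le_iff_truncated\<close>, \<open>eln_le_iff_truncated_both\<close>).
\<close>

section \<open>Convex representations and circuits\<close>

text \<open>
The same condition as membership in \<open>Lam\<close>, but the values outside \<open>A\<close> are arbitrary.  This avoids
restricting and re-extending functions whenever the support changes.
\<close>
definition weights :: "'a::real_vector set \<Rightarrow> 'a \<Rightarrow> ('a \<Rightarrow> real) \<Rightarrow> bool" where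
  "weights A b l \<longleftrightarrow> (\<forall>a\<in>A. 0 \<le> l a) \<and> sum l A = 1 \<and> (\<Sum>a\<in>A. l a *\<^sub>R a) = b"

lemma convex_hull_weights:
  assumes "finite A"
  shows "b \<in> convex hull A \<longleftrightarrow> (\<exists>l. weights A b l)"
  unfolding convex_hull_finite[OF assms] weights_def by auto

lemma weights_unique:
  fixes A :: "'a::euclidean_space set"
  assumes "\<not> affine_dependent A" "weights A b l" "weights A b m" "a \<in> A"
  shows "l a = m a"
proof (rule ccontr)
  assume "l a \<noteq> m a"
  have fin: "finite A" using assms(1) by (rule aff_independent_finite)
  have "(\<Sum>x\<in>A. l x - m x) = 0" "(\<Sum>x\<in>A. (l x - m x) *\<^sub>R x) = 0"
    using assms by (simp_all add: weights_def sum_subtractf scaleR_left_diff_distrib)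
  with \<open>l a \<noteq> m a\<close> assms(4) have "affine_dependent A"
    unfolding affine_dependent_explicit_finite[OF fin]
    by (intro exI[of _ "\<lambda>x. l x - m x"]) auto
  then show False using assms(1) by simp
qed

lemma weights_extend:
  assumes "finite P" "A \<subseteq> P" "weights A b l"
  shows "weights P b (\<lambda>a. if a \<in> A then l a else 0)"
    and "(\<Sum>a\<in>P. (if a \<in> A then l a else 0) * q a) = (\<Sum>a\<in>A. l a * q a)"
proof -
  have P: "P \<inter> A = A" using assms(2) by blast
  show "weights P b (\<lambda>a. if a \<in> A then l a else 0)"
  proof -
    have "(\<Sum>a\<in>P. (if a \<in> A then l a else 0) *\<^sub>R a) = (\<Sum>a\<in>A. l a *\<^sub>R a)"
      using assms by (intro sum.mono_neutral_cong_right) auto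
    then show ?thesis using assms by (auto simp: weights_def sum.If_cases P)
  qed
  show "(\<Sum>a\<in>P. (if a \<in> A then l a else 0) * q a) = (\<Sum>a\<in>A. l a * q a)"
    using assms by (intro sum.mono_neutral_cong_right) auto
qed

lemma weights_compose:
  assumes m: "weights B b m" and u: "\<And>x. x \<in> B \<Longrightarrow> weights A x (u x)"
  shows "weights A b (\<lambda>a. \<Sum>x\<in>B. m x * u x a)"
  unfolding weights_def
proof (intro conjI ballI)
  fix a assume "a \<in> A"
  then show "0 \<le> (\<Sum>x\<in>B. m x * u x a)"
    using m u by (auto intro!: sum_nonneg simp: weights_def)
next
  have "(\<Sum>a\<in>A. \<Sum>x\<in>B. m x * u x a) = (\<Sum>x\<in>B. m x * sum (u x) A)"
    by (subst sum.swap) (simp add: sum_distrib_left)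
  also have "\<dots> = 1" using m u by (simp add: weights_def)
  finally show "(\<Sum>a\<in>A. \<Sum>x\<in>B. m x * u x a) = 1" .
next
  have "(\<Sum>a\<in>A. (\<Sum>x\<in>B. m x * u x a) *\<^sub>R a) = (\<Sum>x\<in>B. m x *\<^sub>R (\<Sum>a\<in>A. u x a *\<^sub>R a))"
    by (simp add: scaleR_sum_left scaleR_sum_right) (rule sum.swap)
  also have "\<dots> = b" using m u by (simp add: weights_def)
  finally show "(\<Sum>a\<in>A. (\<Sum>x\<in>B. m x * u x a) *\<^sub>R a) = b" .
qed

text \<open>
The difference of the two sides is the variance \<open>\<Sum> l\<^sub>a \<parallel>a - b\<parallel>\<^sup>2\<close>, positive because some point with
positive weight differs from \<open>b\<close>.
\<close>
lemma weighted_norm_strict: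
  fixes b :: "'a::real_inner"
  assumes "finite A" "weights A b l" "b \<notin> A"
  shows "b \<bullet> b < (\<Sum>a\<in>A. l a * (a \<bullet> a))"
proof -
  have l: "\<And>a. a \<in> A \<Longrightarrow> 0 \<le> l a" "sum l A = 1" "(\<Sum>a\<in>A. l a *\<^sub>R a) = b"
    using assms(2) by (auto simp: weights_def)
  obtain c where c: "c \<in> A" "l c \<noteq> 0"
    using l(2) by (metis sum.neutral zero_neq_one)
  have "0 < l c * ((c - b) \<bullet> (c - b))"
    using c l(1)[of c] assms(3) by (intro mult_pos_pos) auto
  then have "0 < (\<Sum>a\<in>A. l a * ((a - b) \<bullet> (a - b)))"
    using c l(1) assms(1) by (intro sum_pos2[of A c]) auto
  also have "\<dots> = (\<Sum>a\<in>A. l a * (a \<bullet> a) - 2 * (l a * (a \<bullet> b)) + l a * (b \<bullet> b))"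
    by (intro sum.cong) (auto simp: inner_diff_left inner_diff_right inner_commute algebra_simps)
  also have "\<dots> = (\<Sum>a\<in>A. l a * (a \<bullet> a)) - 2 * ((\<Sum>a\<in>A. l a *\<^sub>R a) \<bullet> b) + sum l A * (b \<bullet> b)"
    by (simp add: inner_sum_left sum.distrib sum_subtractf sum_distrib_left sum_distrib_right)
  finally show ?thesis using l by simp
qed

lemma circuit_weights_pos:
  assumes "circuit A b" "weights A b l" "a \<in> A"
  shows "0 < l a"
proof -
  have ind: "\<not> affine_dependent A" using assms(1) by (simp add: circuit_def)
  obtain u where u: "\<forall>x\<in>A. 0 < u x" "sum u A = 1" "(\<Sum>x\<in>A. u x *\<^sub>R x) = b"
    using assms(1) unfolding circuit_def rel_interior_convex_hull_explicit[OF ind] by blast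
  have "weights A b u" using u by (auto simp: weights_def)
  then show ?thesis using weights_unique[OF ind assms(2) _ assms(3)] u(1) assms(3) by metis
qed

text \<open>
A linear functional on a polytope attains its minimum at a vertex.  As long as the support is
affinely dependent, move the weights along a dependence in the direction that does not increase
the functional, until some weight vanishes.
\<close>
lemma circuit_below_weights:
  fixes q :: "real^'n::finite \<Rightarrow> real"
  assumes "finite P" "weights P b l"
  shows "\<exists>A m. A \<subseteq> P \<and> circuit A b \<and> weights A b m \<and> (\<Sum>a\<in>A. m a * q a) \<le> (\<Sum>a\<in>P. l a * q a)"
  using assms
proof (induction "card P" arbitrary: P l rule: less_induct)
  case less
  note fin = \<open>finite P\<close>
  have l: "\<And>a. a \<in> P \<Longrightarrow> 0 \<le> l a" "sum l P = 1" "(\<Sum>a\<in>P. l a *\<^sub>R a) = b"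
    using less.prems by (auto simp: weights_def)
  have drop: ?case if a: "a \<in> P" "k a = 0" and k: "weights P b k"
    and le: "(\<Sum>a\<in>P. k a * q a) \<le> (\<Sum>a\<in>P. l a * q a)" for a k
  proof -
    have "card (P - {a}) < card P" using a fin by (intro card_Diff1_less)
    moreover have "weights (P - {a}) b k"
      using k a fin by (simp add: weights_def sum_diff1)
    moreover have "(\<Sum>x\<in>P - {a}. k x * q x) = (\<Sum>x\<in>P. k x * q x)"
      using a fin by (simp add: sum_diff1)
    ultimately obtain A m where "A \<subseteq> P - {a}" "circuit A b" "weights A b m"
        "(\<Sum>x\<in>A. m x * q x) \<le> (\<Sum>x\<in>P. k x * q x)"
      using less.hyps[of "P - {a}" k] fin by auto
    then show ?thesis using le by (intro exI[of _ A] exI[of _ m]) auto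
  qed
  show ?case
  proof (cases "\<exists>a\<in>P. l a = 0")
    case True
    then show ?thesis using drop less.prems by blast
  next
    case False
    then have pos: "\<And>a. a \<in> P \<Longrightarrow> 0 < l a" using l(1) by (metis order_le_less)
    show ?thesis
    proof (cases "affine_dependent P")
      case False
      then have "b \<in> rel_interior (convex hull P)"
        unfolding rel_interior_convex_hull_explicit[OF False] using l pos by blast
      then show ?thesis using False less.prems by (auto simp: circuit_def)
    next
      case True
      then obtain u0 where u0: "sum u0 P = 0" "\<exists>x\<in>P. u0 x \<noteq> 0" "(\<Sum>x\<in>P. u0 x *\<^sub>R x) = 0"
        unfolding affine_dependent_explicit_finite[OF fin] by blast
      \<comment> \<open>A dependence or its negative decreases the functional weakly.\<close>
      obtain u where u: "sum u P = 0" "\<exists>x\<in>P. u x \<noteq> 0" "(\<Sum>x\<in>P. u x *\<^sub>R x) = 0"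
        and uq: "(\<Sum>x\<in>P. u x * q x) \<le> 0"
      proof (cases "(\<Sum>x\<in>P. u0 x * q x) \<le> 0")
        case True
        then show ?thesis using u0 that by blast
      next
        case False
        then show ?thesis using u0 that[of "\<lambda>x. - u0 x"] by (simp add: sum_negf)
      qed
      define N where "N = {x \<in> P. u x < 0}"
      have "N \<noteq> {}"
      proof
        assume "N = {}"
        then have "\<forall>x\<in>P. 0 \<le> u x" by (force simp: N_def)
        then have "\<forall>x\<in>P. u x = 0" using sum_nonneg_eq_0_iff[of P u] u(1) fin by auto
        then show False using u(2) by blast
      qed
      have finN: "finite N" using fin by (simp add: N_def)
      \<comment> \<open>The largest step that keeps all weights non-negative; it makes the weight of the minimiser zero.\<close>
      define t where "t = Min ((\<lambda>x. l x / - u x) ` N)"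
      have "t \<in> (\<lambda>x. l x / - u x) ` N" unfolding t_def using finN \<open>N \<noteq> {}\<close> by (intro Min_in) auto
      then obtain a where a: "a \<in> N" "t = l a / - u a" by blast
      have aP: "a \<in> P" "u a < 0" using a by (auto simp: N_def)
      have t0: "0 \<le> t" unfolding a(2) using aP l(1)[of a] by (intro divide_nonneg_pos) auto
      define k where "k x = l x + t * u x" for x
      have "0 \<le> k x" if "x \<in> P" for x
      proof (cases "u x < 0")
        case True
        then have "t \<le> l x / - u x" unfolding t_def using that finN by (intro Min_le) (auto simp: N_def)
        then have "t * - u x \<le> l x" using True pos_le_divide_eq[of "- u x" t "l x"] by linarith
        then show ?thesis by (simp add: k_def)
      next
        case False
        then show ?thesis using l(1)[OF that] t0 by (simp add: k_def)
      qed
      moreover have "sum k P = 1"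
        using l(2) u(1) by (simp add: k_def sum.distrib flip: sum_distrib_left)
      moreover have "(\<Sum>x\<in>P. k x *\<^sub>R x) = b"
        using l(3) u(3) by (simp add: k_def sum.distrib scaleR_left_distrib
            flip: scaleR_scaleR scaleR_sum_right)
      ultimately have "weights P b k" by (simp add: weights_def)
      moreover have "(\<Sum>x\<in>P. k x * q x) \<le> (\<Sum>x\<in>P. l x * q x)"
      proof -
        have "(\<Sum>x\<in>P. k x * q x) = (\<Sum>x\<in>P. l x * q x) + t * (\<Sum>x\<in>P. u x * q x)"
          by (simp add: k_def algebra_simps sum.distrib sum_distrib_left)
        then show ?thesis using t0 uq by (simp add: mult_nonneg_nonpos)
      qed
      moreover have "k a = 0" unfolding k_def a(2) using aP by simp
      ultimately show ?thesis using drop aP(1) by blast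
    qed
  qed
qed

section \<open>Reduced circuits suffice\<close>

text \<open>
Take the circuit that minimises the weighted sum of squared norms of its points.  If the hull of
\<open>A\<close> contained another point \<open>p\<close> of \<open>P\<close>, shifting some weight from \<open>A\<close> to \<open>p\<close> would strictly decrease
that sum.  For \<open>p = b\<close> this excludes \<open>b \<in> P - A\<close>, so if \<open>b \<in> P\<close> then \<open>A = {b}\<close>.
\<close>
lemma reduced_circuit_exists:
  fixes P :: "(real^'n::finite) set"
  assumes "finite P" "b \<in> convex hull P"
  shows "\<exists>A \<subseteq> P. circuit A b \<and> (convex hull A - A) \<inter> P = {}"
proof -
  define Q where "Q A m = (\<Sum>a\<in>A. m a * (a \<bullet> a))" for A and m :: "real^'n \<Rightarrow> real"
  define C where "C = {A. A \<subseteq> P \<and> circuit A b}"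
  have finC: "finite C" using assms(1) by (simp add: C_def)
  have "C \<noteq> {}"
    using assms circuit_below_weights[of P b _ "\<lambda>_. 0"] by (auto simp: C_def convex_hull_weights)
  have wex: "\<exists>m. weights A b m" if "A \<in> C" for A
  proof -
    have "b \<in> convex hull A" "finite A"
      using that rel_interior_subset finite_subset[OF _ assms(1)] by (auto simp: C_def circuit_def)
    then show ?thesis using convex_hull_weights by blast
  qed
  then obtain w where w: "\<And>A. A \<in> C \<Longrightarrow> weights A b (w A)" by metis
  obtain A where A: "A \<in> C" and min: "\<And>B. B \<in> C \<Longrightarrow> Q A (w A) \<le> Q B (w B)"
  proof (rule that)
    show "arg_min_on (\<lambda>A. Q A (w A)) C \<in> C"
      by (rule arg_min_if_finite(1)[OF finC \<open>C \<noteq> {}\<close>])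
  qed (rule arg_min_least[OF finC \<open>C \<noteq> {}\<close>])
  have finA: "finite A" and AP: "A \<subseteq> P" and circ: "circuit A b"
    using A assms(1) finite_subset by (auto simp: C_def)
  have False if p: "p \<in> convex hull A" "p \<notin> A" "p \<in> P" for p
  proof -
    obtain u where u: "weights A p u" using p(1) convex_hull_weights[OF finA] by blast
    have u1: "u a \<le> 1" if "a \<in> A" for a
      using u that finA member_le_sum[of a A u] by (simp add: weights_def)
    \<comment> \<open>All weights of a circuit are positive, and the weights \<open>u\<close> are at most 1, so \<open>t\<close> times \<open>u\<close> can be removed.\<close>
    define t where "t = Min (w A ` A)"
    have "A \<noteq> {}" using p(1) by auto
    then have "t \<in> w A ` A" unfolding t_def using finA by simp
    then have t0: "0 < t" using circuit_weights_pos[OF circ w[OF A]] by auto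
    have t_le: "t \<le> w A a" if "a \<in> A" for a unfolding t_def using that finA by simp
    define k where "k a = (if a = p then t else w A a - t * u a)" for a
    have kA: "k a = w A a - t * u a" if "a \<in> A" for a using that p(2) by (auto simp: k_def)
    have sumA: "(\<Sum>a\<in>insert p A. k a *\<^sub>R f a) =
        t *\<^sub>R f p + ((\<Sum>a\<in>A. w A a *\<^sub>R f a) - t *\<^sub>R (\<Sum>a\<in>A. u a *\<^sub>R f a))"
      for f :: "real^'n \<Rightarrow> 'b::real_vector"
      using finA p(2) kA
      by (simp add: k_def scaleR_left_diff_distrib sum_subtractf scaleR_sum_right)
    have "weights (insert p A) b k"
    proof -
      have "0 \<le> k a" if "a \<in> A" for a
      proof -
        have "t * u a \<le> t" using u1[OF that] t0 by simp
        then show ?thesis using t_le[OF that] kA[OF that] by simp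
      qed
      moreover have "sum k (insert p A) = 1"
        using sumA[of "\<lambda>_. 1::real"] u w[OF A] by (simp add: weights_def)
      moreover have "(\<Sum>a\<in>insert p A. k a *\<^sub>R a) = b"
        using sumA[of "\<lambda>a. a"] u w[OF A] by (simp add: weights_def)
      ultimately show ?thesis using t0 by (auto simp: weights_def k_def)
    qed
    from circuit_below_weights[OF _ this, of "\<lambda>a. a \<bullet> a"] finA
    obtain B m where B: "B \<subseteq> insert p A" "circuit B b" "weights B b m"
        "Q B m \<le> (\<Sum>a\<in>insert p A. k a * (a \<bullet> a))"
      unfolding Q_def by auto
    have BC: "B \<in> C" using B AP p(3) by (auto simp: C_def)
    have "Q B (w B) = Q B m"
      unfolding Q_def
      using weights_unique[OF _ w[OF BC] B(3)] B(2) by (intro sum.cong refl) (simp add: circuit_def)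
    also have "\<dots> \<le> t * (p \<bullet> p) + (Q A (w A) - t * Q A u)"
      using B(4) sumA[of "\<lambda>a. a \<bullet> a"] by (simp add: Q_def)
    also have "\<dots> < Q A (w A)"
      using weighted_norm_strict[OF finA u p(2)] t0 by (simp add: Q_def)
    finally show False using min[OF BC] by simp
  qed
  then have "(convex hull A - A) \<inter> P = {}" by blast
  then show ?thesis using AP circ by auto
qed

text \<open>
The affine function on the simplex spanned by \<open>A\<close> with the values of \<open>h\<close> at the vertices.  Barycentric
coordinates define it, and their uniqueness makes it compatible with convex combinations.
\<close>
lemma affine_interpolation:
  assumes ind: "\<not> affine_dependent A"
  obtains G :: "'a::euclidean_space \<Rightarrow> real" where
    "\<And>x l. weights A x l \<Longrightarrow> G x = (\<Sum>a\<in>A. l a * h a)"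
    "\<And>B x m. B \<subseteq> convex hull A \<Longrightarrow> weights B x m \<Longrightarrow> G x = (\<Sum>a\<in>B. m a * G a)"
proof -
  have fin: "finite A" using ind by (rule aff_independent_finite)
  define u where "u x = (SOME l. weights A x l)" for x
  have u: "weights A x (u x)" if "x \<in> convex hull A" for x
    unfolding u_def using that convex_hull_weights[OF fin] by (metis someI)
  define G where "G x = (\<Sum>a\<in>A. u x a * h a)" for x
  have 1: "G x = (\<Sum>a\<in>A. l a * h a)" if "weights A x l" for x l
  proof -
    have "x \<in> convex hull A" using that convex_hull_weights[OF fin] by blast
    then show ?thesis unfolding G_def using weights_unique[OF ind u that] by simp
  qed
  moreover have "G x = (\<Sum>a\<in>B. m a * G a)"
    if B: "B \<subseteq> convex hull A" "weights B x m" for B x m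
  proof -
    have "G x = (\<Sum>a\<in>A. (\<Sum>y\<in>B. m y * u y a) * h a)"
      using B u by (intro 1 weights_compose) auto
    also have "\<dots> = (\<Sum>y\<in>B. m y * G y)"
      unfolding G_def sum_distrib_left sum_distrib_right by (subst sum.swap) (simp add: mult.assoc)
    finally show ?thesis .
  qed
  ultimately show ?thesis using that by blast
qed

text \<open>
A circuit that violates its inequality makes the difference \<open>K\<close> of \<open>h\<close> and its interpolation
positive somewhere on \<open>\<A> \<inter> conv A\<close>.  At the longest of the maximisers of \<open>K\<close>, the inequality of a
reduced circuit within \<open>conv A\<close> must fail.
\<close>
lemma reduced_even_imp_convex:
  fixes h :: "real^'n::finite \<Rightarrow> real"
  assumes fin: "finite \<A>"
    and red: "\<And>A b m. A \<subseteq> \<A> \<Longrightarrow> b \<in> \<A> \<Longrightarrow> circuit A b \<Longrightarrow> (convex hull A - (A \<union> {b})) \<inter> \<A> = {} \<Longrightarrow>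
        weights A b m \<Longrightarrow> h b \<le> (\<Sum>a\<in>A. m a * h a)"
    and b0: "b0 \<in> \<A>" and l: "weights \<A> b0 l"
  shows "h b0 \<le> (\<Sum>a\<in>\<A>. l a * h a)"
proof (rule ccontr)
  assume neg: "\<not> ?thesis"
  obtain A m where A: "A \<subseteq> \<A>" "circuit A b0" "weights A b0 m"
      "(\<Sum>a\<in>A. m a * h a) \<le> (\<Sum>a\<in>\<A>. l a * h a)"
    using circuit_below_weights[OF fin l] by blast
  have finA: "finite A" using A(1) fin finite_subset by blast
  have ind: "\<not> affine_dependent A" using A(2) by (simp add: circuit_def)
  obtain G where G1: "\<And>x l. weights A x l \<Longrightarrow> G x = (\<Sum>a\<in>A. l a * h a)"
    and G2: "\<And>B x m. B \<subseteq> convex hull A \<Longrightarrow> weights B x m \<Longrightarrow> G x = (\<Sum>a\<in>B. m a * G a)"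
    using affine_interpolation[OF ind] by blast
  define K where "K x = h x - G x" for x
  define P where "P = \<A> \<inter> convex hull A"
  have finP: "finite P" using fin by (simp add: P_def)
  have b0P: "b0 \<in> P" using b0 A(3) convex_hull_weights[OF finA] by (auto simp: P_def)
  have K0: "0 < K b0" using neg A(4) G1[OF A(3)] by (simp add: K_def)
  have KA: "K a = 0" if "a \<in> A" for a
  proof -
    have "weights A a (\<lambda>x. if x = a then 1 else 0)"
      using that finA by (simp add: weights_def if_distrib[of "\<lambda>c. c *\<^sub>R _"] cong: if_cong)
    from G1[OF this] have "G a = (\<Sum>x\<in>A. if x = a then h x else 0)"
      by (simp add: if_distrib[of "\<lambda>c. c * _"] cong: if_cong)
    then show ?thesis using that finA by (simp add: K_def)
  qed
  \<comment> \<open>The tie between maximisers is broken by the norm, so that \<open>b\<close> is not a convex combination of other maximisers.\<close>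
  define M where "M = {x \<in> P. \<forall>y\<in>P. K y \<le> K x}"
  have "M \<noteq> {}"
  proof -
    have "Max (K ` P) \<in> K ` P" using finP b0P by (intro Max_in) auto
    then obtain x where "x \<in> P" "K x = Max (K ` P)" by auto
    then have "x \<in> M" using finP by (auto simp: M_def)
    then show ?thesis by blast
  qed
  moreover have finM: "finite M" using finP by (simp add: M_def)
  ultimately have "Max ((\<lambda>x. x \<bullet> x) ` M) \<in> (\<lambda>x. x \<bullet> x) ` M" by (intro Max_in) auto
  then obtain b where b: "b \<in> M" and "b \<bullet> b = Max ((\<lambda>x. x \<bullet> x) ` M)" by auto
  then have bmax: "x \<bullet> x \<le> b \<bullet> b" if "x \<in> M" for x using finM that by simp
  have bP: "b \<in> P" and Kb: "\<And>y. y \<in> P \<Longrightarrow> K y \<le> K b" using b by (auto simp: M_def)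
  \<comment> \<open>\<open>K\<close> vanishes on \<open>A\<close>, so \<open>b\<close> still lies in the hull after it is removed from \<open>P\<close>.\<close>
  have "b \<notin> A" using KA Kb[OF b0P] K0 by fastforce
  then have "A \<subseteq> P - {b}" using A(1) by (auto simp: P_def intro: hull_inc)
  then have "b \<in> convex hull (P - {b})" using bP hull_mono[of A "P - {b}" convex] by (auto simp: P_def)
  then obtain B where B: "B \<subseteq> P - {b}" "circuit B b" "(convex hull B - B) \<inter> (P - {b}) = {}"
    using reduced_circuit_exists[of "P - {b}" b] finP by auto
  have finB: "finite B" using B(1) finP finite_subset by blast
  have BA: "B \<subseteq> convex hull A" using B(1) by (auto simp: P_def)
  have "b \<in> convex hull B" using B(2) rel_interior_subset by (auto simp: circuit_def)
  then obtain k where k: "weights B b k" using convex_hull_weights[OF finB] by blast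
  have "convex hull B \<subseteq> convex hull A" using BA by (simp add: subset_hull)
  then have "h b \<le> (\<Sum>a\<in>B. k a * h a)"
    using B k bP by (intro red) (auto simp: P_def)
  then have "K b \<le> (\<Sum>a\<in>B. k a * K a)"
    using G2[OF BA k] by (simp add: K_def algebra_simps sum_subtractf)
  then have "(\<Sum>a\<in>B. k a * (K b - K a)) \<le> 0"
    using k by (simp add: weights_def algebra_simps sum_subtractf flip: sum_distrib_left)
  moreover have nn: "0 \<le> k a * (K b - K a)" if "a \<in> B" for a
    using that Kb[of a] B(1) k by (auto simp: weights_def)
  ultimately have "(\<Sum>a\<in>B. k a * (K b - K a)) = 0"
    by (meson antisym sum_nonneg)
  then have eq: "k a * (K b - K a) = 0" if "a \<in> B" for a
    using sum_nonneg_eq_0_iff[OF finB, of "\<lambda>a. k a * (K b - K a)"] nn that by blast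
  have "a \<in> M" if "a \<in> B" for a
    using eq[OF that] circuit_weights_pos[OF B(2) k that] that Kb B(1) by (auto simp: M_def)
  then have "(\<Sum>a\<in>B. k a * (a \<bullet> a)) \<le> (\<Sum>a\<in>B. k a * (b \<bullet> b))"
    using bmax k by (intro sum_mono mult_left_mono) (auto simp: weights_def)
  also have "\<dots> = b \<bullet> b" using k by (simp add: weights_def flip: sum_distrib_right)
  finally show False using weighted_norm_strict[OF finB k] B(1) by auto
qed

text \<open>
A reduced circuit \<open>B\<close> inside \<open>conv A\<close> yields a bound at the points of \<open>B\<close>; by \<open>cvx\<close> these values are
at most those of the interpolation from \<open>A\<close>, which turns the bound into the one for \<open>A\<close>.
\<close>
lemma reduced_odd_imp_below:
  fixes h :: "real^'n::finite \<Rightarrow> real"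
  assumes fin: "finite \<A>"
    and cvx: "\<And>a l. a \<in> \<A> \<Longrightarrow> weights \<A> a l \<Longrightarrow> h a \<le> (\<Sum>x\<in>\<A>. l x * h x)"
    and red: "\<And>A m. A \<subseteq> \<A> \<Longrightarrow> circuit A b \<Longrightarrow> (convex hull A - A) \<inter> \<A> = {} \<Longrightarrow>
        weights A b m \<Longrightarrow> s \<le> (\<Sum>a\<in>A. m a * h a)"
    and l: "weights \<A> b l"
  shows "s \<le> (\<Sum>a\<in>\<A>. l a * h a)"
proof -
  obtain A m where A: "A \<subseteq> \<A>" "circuit A b" "weights A b m"
      "(\<Sum>a\<in>A. m a * h a) \<le> (\<Sum>a\<in>\<A>. l a * h a)"
    using circuit_below_weights[OF fin l] by blast
  have finA: "finite A" using A(1) fin finite_subset by blast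
  have ind: "\<not> affine_dependent A" using A(2) by (simp add: circuit_def)
  obtain G where G1: "\<And>x l. weights A x l \<Longrightarrow> G x = (\<Sum>a\<in>A. l a * h a)"
    and G2: "\<And>B x m. B \<subseteq> convex hull A \<Longrightarrow> weights B x m \<Longrightarrow> G x = (\<Sum>a\<in>B. m a * G a)"
    using affine_interpolation[OF ind] by blast
  define P where "P = \<A> \<inter> convex hull A"
  have "A \<subseteq> P" using A(1) by (auto simp: P_def intro: hull_inc)
  moreover have "b \<in> convex hull A" using A(3) convex_hull_weights[OF finA] by blast
  ultimately have "b \<in> convex hull P" using hull_mono by blast
  then obtain B where B: "B \<subseteq> P" "circuit B b" "(convex hull B - B) \<inter> P = {}"
    using reduced_circuit_exists[of P b] fin by (auto simp: P_def)
  have finB: "finite B" using B(1) fin finite_subset by (auto simp: P_def)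
  have BA: "B \<subseteq> convex hull A" using B(1) by (auto simp: P_def)
  have "b \<in> convex hull B" using B(2) rel_interior_subset by (auto simp: circuit_def)
  then obtain k where k: "weights B b k" using convex_hull_weights[OF finB] by blast
  have "convex hull B \<subseteq> convex hull A" using BA by (simp add: subset_hull)
  then have "s \<le> (\<Sum>a\<in>B. k a * h a)"
    using B k by (intro red) (auto simp: P_def)
  also have "\<dots> \<le> (\<Sum>a\<in>B. k a * G a)"
  proof (intro sum_mono mult_left_mono)
    fix a assume a: "a \<in> B"
    then obtain u where u: "weights A a u" using BA convex_hull_weights[OF finA] by blast
    show "h a \<le> G a"
      using cvx[OF _ weights_extend(1)[OF fin A(1) u]] weights_extend(2)[OF fin A(1) u] G1[OF u] a B(1)
      by (auto simp: P_def)
    show "0 \<le> k a" using a k by (simp add: weights_def)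
  qed
  also have "\<dots> = G b" using G2[OF BA k] by simp
  also have "\<dots> \<le> (\<Sum>a\<in>\<A>. l a * h a)" using G1[OF A(3)] A(4) by simp
  finally show ?thesis .
qed

section \<open>Linear programming duality\<close>

text \<open>
Strong duality for minimising \<open>\<Sum> l\<^sub>a h\<^sub>a\<close> over the representations of \<open>b\<close>, in its strict form.  The
convex cone generated by the points \<open>(a, 1, h\<^sub>a)\<close> and the upward direction is finitely generated,
hence closed, and it does not contain \<open>(b, 1, s)\<close>; a separating hyperplane gives the affine
function.  If the hyperplane is vertical, \<open>b\<close> lies outside the hull of \<open>A\<close>, and a sufficiently
large multiple of the hyperplane's linear form serves.
\<close>
lemma separating_affine_function:
  fixes A :: "'a::euclidean_space set"
  assumes fin: "finite A"
    and less: "\<And>l. weights A b l \<Longrightarrow> s < (\<Sum>a\<in>A. l a * h a)"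
  shows "\<exists>y k. (\<forall>a\<in>A. y \<bullet> a + k \<le> h a) \<and> s \<le> y \<bullet> b + k"
proof -
  define S :: "('a \<times> real \<times> real) set" where "S = insert (0, 0, 1) ((\<lambda>a. (a, 1, h a)) ` A)"
  define C where "C = convex_cone hull S"
  define R where "R = {((\<Sum>a\<in>A. l a *\<^sub>R a), sum l A, (\<Sum>a\<in>A. l a * h a) + r) | l r.
      (\<forall>a\<in>A. 0 \<le> l a) \<and> 0 \<le> (r::real)}"
  have RI: "z \<in> R" if "\<And>a. a \<in> A \<Longrightarrow> 0 \<le> l a" "0 \<le> r"
      "z = ((\<Sum>a\<in>A. l a *\<^sub>R a), sum l A, (\<Sum>a\<in>A. l a * h a) + r)" for z l r
    using that by (auto simp: R_def)
  have "C \<subseteq> R"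
    unfolding C_def
  proof (rule hull_minimal)
    show "S \<subseteq> R"
    proof
      fix z assume "z \<in> S"
      then consider "z = (0, 0, 1)" | a where "a \<in> A" "z = (a, 1, h a)" by (auto simp: S_def)
      then show "z \<in> R"
      proof cases
        case 1
        then show ?thesis by (intro RI[of "\<lambda>_. 0" 1]) auto
      next
        case 2
        then show ?thesis
          using fin by (intro RI[of "\<lambda>x. if x = a then 1 else 0" 0])
            (auto simp: if_distrib[of "\<lambda>c. c *\<^sub>R _"] if_distrib[of "\<lambda>c. c * _"] cong: if_cong)
      qed
    qed
    show "convex_cone R"
      unfolding convex_cone_iff
    proof (intro conjI ballI allI impI)
      show "0 \<in> R" by (intro RI[of "\<lambda>_. 0" 0]) (auto simp: zero_prod_def)
      fix x assume x: "x \<in> R"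
      then obtain l r where l: "\<And>a. a \<in> A \<Longrightarrow> 0 \<le> l a" "0 \<le> r"
          "x = ((\<Sum>a\<in>A. l a *\<^sub>R a), sum l A, (\<Sum>a\<in>A. l a * h a) + r)"
        by (auto simp: R_def)
      show "x + z \<in> R" if z: "z \<in> R" for z
      proof -
        obtain m q where m: "\<And>a. a \<in> A \<Longrightarrow> 0 \<le> m a" "0 \<le> q"
            "z = ((\<Sum>a\<in>A. m a *\<^sub>R a), sum m A, (\<Sum>a\<in>A. m a * h a) + q)"
          using z by (auto simp: R_def)
        show ?thesis
          by (rule RI[of "\<lambda>a. l a + m a" "r + q"])
            (use l m in \<open>auto simp: scaleR_left_distrib sum.distrib distrib_right\<close>)
      qed
      show "c *\<^sub>R x \<in> R" if "0 \<le> c" for c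
        by (rule RI[of "\<lambda>a. c * l a" "c * r"])
          (use l that in \<open>auto simp: scaleR_sum_right sum_distrib_left algebra_simps\<close>)
    qed
  qed
  have "(b, 1, s) \<notin> C"
  proof
    assume "(b, 1, s) \<in> C"
    then obtain l r where "\<forall>a\<in>A. 0 \<le> l a" "0 \<le> r" "b = (\<Sum>a\<in>A. l a *\<^sub>R a)" "1 = sum l A"
        "s = (\<Sum>a\<in>A. l a * h a) + r"
      using \<open>C \<subseteq> R\<close> by (auto simp: R_def)
    then show False using less[of l] by (auto simp: weights_def)
  qed
  moreover have "closed C" unfolding C_def using fin by (intro closed_convex_cone_hull) (simp add: S_def)
  moreover have cone: "convex_cone C" by (simp add: C_def convex_cone_convex_cone_hull)
  ultimately obtain p c where p: "p \<bullet> (b, 1, s) < c" "\<And>x. x \<in> C \<Longrightarrow> c < p \<bullet> x"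
    using separating_hyperplane_closed_point[of C "(b, 1, s)"]
    by (metis convex_cone_def)
  have c0: "c < 0" using p(2)[of 0] cone by (simp add: convex_cone_contains_0)
  have pos: "0 \<le> p \<bullet> x" if "x \<in> C" for x
  proof (rule ccontr)
    assume "\<not> ?thesis"
    then have neg: "p \<bullet> x < 0" by simp
    then have "0 \<le> c / (p \<bullet> x)" using c0 by (simp add: divide_nonpos_neg)
    then have "(c / (p \<bullet> x)) *\<^sub>R x \<in> C" using convex_cone_scaleR[OF cone] that by blast
    from p(2)[OF this] show False using neg by simp
  qed
  obtain p1 p2 p3 where pe: "p = (p1, p2, p3)" by (cases p)
  have SC: "S \<subseteq> C" unfolding C_def by (rule hull_subset)
  have p3: "0 \<le> p3" using pos[of "(0, 0, 1)"] SC by (auto simp: S_def pe)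
  have pA: "0 \<le> p1 \<bullet> a + p2 + p3 * h a" if "a \<in> A" for a
    using pos[of "(a, 1, h a)"] SC that by (auto simp: S_def pe algebra_simps)
  have pb: "p1 \<bullet> b + p2 + p3 * s < 0" using p(1) c0 by (simp add: pe algebra_simps)
  show ?thesis
  proof (cases "p3 = 0")
    case False
    then have p3: "0 < p3" using p3 by simp
    define y where "y = (- 1 / p3) *\<^sub>R p1"
    have y: "y \<bullet> z + - p2 / p3 = - (p1 \<bullet> z + p2) / p3" for z by (simp add: y_def diff_divide_distrib)
    show ?thesis
    proof (intro exI[of _ y] exI[of _ "- p2 / p3"] conjI ballI)
      show "y \<bullet> a + - p2 / p3 \<le> h a" if "a \<in> A" for a
        unfolding y using pA[OF that] p3 by (simp add: pos_divide_le_eq mult.commute)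
      show "s \<le> y \<bullet> b + - p2 / p3"
        unfolding y using pb p3 by (simp add: pos_le_divide_eq mult.commute)
    qed
  next
    case True
    define m where "m = Min (h ` A)"
    define d where "d = - (p1 \<bullet> b + p2)"
    have d: "0 < d" using pb True by (simp add: d_def)
    define T where "T = \<bar>s - m\<bar> / d"
    have T: "0 \<le> T" "s - m \<le> T * d" using d by (auto simp: T_def)
    show ?thesis
    proof (intro exI[of _ "(- T) *\<^sub>R p1"] exI[of _ "m - T * p2"] conjI ballI)
      show "((- T) *\<^sub>R p1) \<bullet> a + (m - T * p2) \<le> h a" if "a \<in> A" for a
      proof -
        have "m \<le> h a" unfolding m_def using fin that by simp
        moreover have "0 \<le> T * (p1 \<bullet> a + p2)" using pA[OF that] True T by simp
        ultimately show ?thesis by (simp add: algebra_simps)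
      qed
      show "s \<le> ((- T) *\<^sub>R p1) \<bullet> b + (m - T * p2)"
        using T(2) by (simp add: d_def algebra_simps)
    qed
  qed
qed

text \<open>
For every \<open>u < t\<close> an affine function \<open>y \<bullet> a + k\<close> separates \<open>ln u\<close> at \<open>b\<close> from \<open>ln v\<close> on \<open>A\<close>.
Evaluating the signomial inequality at this \<open>y\<close> and multiplying by \<open>exp k\<close> gives the claim with
\<open>u\<close> in place of \<open>t\<close>.
\<close>
lemma nonneg_signomial_imp_pairing:
  fixes A :: "'a::euclidean_space set"
  assumes fin: "finite A" and v: "\<And>a. a \<in> A \<Longrightarrow> 0 < v a" and t: "0 < t"
    and ln: "\<And>l. weights A b l \<Longrightarrow> ln t \<le> (\<Sum>a\<in>A. l a * ln (v a))"
    and c: "\<And>a. a \<in> A \<Longrightarrow> 0 \<le> c a" and D: "0 \<le> D"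
    and nonneg: "\<And>y. D * exp (b \<bullet> y) \<le> (\<Sum>a\<in>A. c a * exp (a \<bullet> y))"
  shows "D * t \<le> (\<Sum>a\<in>A. c a * v a)"
proof (cases "D = 0")
  case True
  then show ?thesis using c v by (simp add: sum_nonneg less_imp_le)
next
  case False
  then have D: "0 < D" using D by simp
  have "u \<le> (\<Sum>a\<in>A. c a * v a) / D" if u: "0 < u" "u < t" for u
  proof -
    have "ln u < (\<Sum>a\<in>A. l a * ln (v a))" if "weights A b l" for l
      using ln[OF that] u ln_less_cancel_iff[of u t] by linarith
    then obtain y k where y: "\<And>a. a \<in> A \<Longrightarrow> y \<bullet> a + k \<le> ln (v a)" "ln u \<le> y \<bullet> b + k"
      using separating_affine_function[OF fin, where h = "\<lambda>a. ln (v a)"] by meson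
    have "D * u \<le> D * exp (y \<bullet> b + k)"
      using D u(1) iffD2[OF exp_le_cancel_iff y(2)] by simp
    also have "\<dots> = D * exp (b \<bullet> y) * exp k" by (simp add: exp_add inner_commute)
    also have "\<dots> \<le> (\<Sum>a\<in>A. c a * exp (a \<bullet> y)) * exp k" using nonneg by (simp add: mult_right_mono)
    also have "\<dots> = (\<Sum>a\<in>A. c a * exp (y \<bullet> a + k))"
      by (simp add: sum_distrib_right exp_add inner_commute mult.assoc)
    also have "\<dots> \<le> (\<Sum>a\<in>A. c a * v a)"
    proof (intro sum_mono mult_left_mono)
      fix a assume a: "a \<in> A"
      show "exp (y \<bullet> a + k) \<le> v a" using iffD2[OF exp_le_cancel_iff y(1)[OF a]] v[OF a] by simp
    qed (use c in auto)
    finally show ?thesis using D by (simp add: pos_le_divide_eq mult.commute)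
  qed
  then have "t \<le> (\<Sum>a\<in>A. c a * v a) / D" using dense_le_bounded[OF t] by blast
  then show ?thesis using D by (simp add: pos_le_divide_eq mult.commute)
qed

section \<open>Truncation of zero values\<close>

lemma le_sum_truncation_limit:
  fixes c v :: "'a \<Rightarrow> real"
  assumes c: "\<And>a. a \<in> A \<Longrightarrow> 0 \<le> c a" and v: "\<And>a. a \<in> A \<Longrightarrow> 0 \<le> v a"
    and le: "\<And>e. 0 < e \<Longrightarrow> T \<le> (\<Sum>a\<in>A. c a * max (v a) e)"
  shows "T \<le> (\<Sum>a\<in>A. c a * v a)"
proof (rule field_le_epsilon)
  fix e :: real assume e: "0 < e"
  have C: "0 \<le> sum c A" using c by (rule sum_nonneg)
  define d where "d = e / (sum c A + 1)"
  have d: "0 < d" using e C by (simp add: d_def)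
  have "T \<le> (\<Sum>a\<in>A. c a * max (v a) d)" by (rule le[OF d])
  also have "\<dots> \<le> (\<Sum>a\<in>A. c a * (v a + d))"
    using c v d by (intro sum_mono mult_left_mono) (auto simp: max_def)
  also have "\<dots> = (\<Sum>a\<in>A. c a * v a) + sum c A * d"
    by (simp add: distrib_left sum.distrib sum_distrib_right)
  also have "sum c A * d \<le> e" using e C by (simp add: d_def field_simps)
  finally show "T \<le> (\<Sum>a\<in>A. c a * v a) + e" by simp
qed

text \<open>
Only small \<open>e\<close> matter.  Once \<open>e\<close> is below all positive values of \<open>v\<close>, the truncated sum equals
\<open>S + L ln e\<close>, where \<open>L\<close> is the total weight on the zeros of \<open>v\<close>.  It is constant if \<open>L = 0\<close> and tends
to \<open>-\<infinity>\<close> otherwise, exactly as the extended real sum prescribes.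
\<close>
lemma eln_le_iff_truncated:
  fixes l v :: "'a \<Rightarrow> real"
  assumes fin: "finite A" and l: "\<And>a. a \<in> A \<Longrightarrow> 0 \<le> l a" and v: "\<And>a. a \<in> A \<Longrightarrow> 0 \<le> v a"
  shows "eln \<bar>s\<bar> \<le> (\<Sum>a\<in>A. ereal (l a) * eln (v a)) \<longleftrightarrow>
    (s \<noteq> 0 \<longrightarrow> (\<forall>e>0. ln \<bar>s\<bar> \<le> (\<Sum>a\<in>A. l a * ln (max (v a) e))))"
proof (cases "s = 0")
  case True
  then show ?thesis by (simp add: eln_def)
next
  case s: False
  define Z where "Z = {a \<in> A. v a = 0}"
  define L where "L = sum l Z"
  define S where "S = (\<Sum>a\<in>A - Z. l a * ln (v a))"
  define e0 where "e0 = Min (insert 1 (v ` (A - Z)))"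
  have finZ: "finite Z" "Z \<subseteq> A" using fin by (auto simp: Z_def)
  have e0: "0 < e0" unfolding e0_def using fin v by (subst Min_gr_iff) (auto simp: Z_def order_less_le)
  have e0_le: "e0 \<le> v a" if "a \<in> A - Z" for a
    unfolding e0_def using fin that by (intro Min_le) auto
  have small: "(\<Sum>a\<in>A. l a * ln (max (v a) e)) = S + L * ln e" if e: "0 < e" "e \<le> e0" for e
  proof -
    have "(\<Sum>a\<in>A. l a * ln (max (v a) e)) =
        (\<Sum>a\<in>A - Z. l a * ln (max (v a) e)) + (\<Sum>a\<in>Z. l a * ln (max (v a) e))"
      using fin finZ by (simp add: sum.subset_diff)
    also have "(\<Sum>a\<in>A - Z. l a * ln (max (v a) e)) = S"
      unfolding S_def
    proof (intro sum.cong refl)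
      fix a assume "a \<in> A - Z"
      then have "max (v a) e = v a" using e0_le e(2) by (intro max_absorb1) (rule order_trans)
      then show "l a * ln (max (v a) e) = l a * ln (v a)" by simp
    qed
    also have "(\<Sum>a\<in>Z. l a * ln (max (v a) e)) = L * ln e"
      unfolding L_def sum_distrib_right using e by (intro sum.cong) (auto simp: Z_def)
    finally show ?thesis .
  qed
  have sum_ereal: "(\<Sum>a\<in>A. ereal (l a) * eln (v a)) =
      ereal S + (\<Sum>a\<in>Z. ereal (l a) * (-\<infinity>))"
  proof -
    have "(\<Sum>a\<in>A. ereal (l a) * eln (v a)) =
        (\<Sum>a\<in>A - Z. ereal (l a) * eln (v a)) + (\<Sum>a\<in>Z. ereal (l a) * eln (v a))"
      using fin finZ by (simp add: sum.subset_diff)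
    also have "(\<Sum>a\<in>A - Z. ereal (l a) * eln (v a)) = (\<Sum>a\<in>A - Z. ereal (l a * ln (v a)))"
      by (intro sum.cong) (auto simp: Z_def eln_def)
    also have "(\<Sum>a\<in>Z. ereal (l a) * eln (v a)) = (\<Sum>a\<in>Z. ereal (l a) * (-\<infinity>))"
      by (intro sum.cong) (auto simp: Z_def eln_def)
    finally show ?thesis by (simp add: S_def)
  qed
  have lZ: "0 \<le> l a" if "a \<in> Z" for a using l that finZ by blast
  have L0: "0 \<le> L" unfolding L_def using lZ by (rule sum_nonneg)
  show ?thesis
  proof (cases "L = 0")
    case True
    then have "\<forall>a\<in>Z. l a = 0" using sum_nonneg_eq_0_iff[of Z l] lZ finZ by (simp add: L_def)
    then have "(\<Sum>a\<in>A. ereal (l a) * eln (v a)) = ereal S" unfolding sum_ereal by simp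
    then have "eln \<bar>s\<bar> \<le> (\<Sum>a\<in>A. ereal (l a) * eln (v a)) \<longleftrightarrow> ln \<bar>s\<bar> \<le> S"
      using s by (simp add: eln_def)
    moreover have mono: "S \<le> (\<Sum>a\<in>A. l a * ln (max (v a) e))" if e: "0 < e" for e
    proof -
      have "S = (\<Sum>a\<in>A. l a * ln (max (v a) (min e e0)))"
        using small[of "min e e0"] e e0 True by simp
      also have "\<dots> \<le> (\<Sum>a\<in>A. l a * ln (max (v a) e))"
      proof (intro sum_mono mult_left_mono)
        fix a assume a: "a \<in> A"
        have "max (v a) (min e e0) \<le> max (v a) e" by auto
        moreover have "0 < max (v a) (min e e0)" using e e0 by (simp add: less_max_iff_disj)
        ultimately show "ln (max (v a) (min e e0)) \<le> ln (max (v a) e)" by simp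
      qed (use l in auto)
      finally show ?thesis .
    qed
    moreover have "ln \<bar>s\<bar> \<le> S \<longleftrightarrow> (\<forall>e>0. ln \<bar>s\<bar> \<le> (\<Sum>a\<in>A. l a * ln (max (v a) e)))"
    proof
      assume "ln \<bar>s\<bar> \<le> S"
      then show "\<forall>e>0. ln \<bar>s\<bar> \<le> (\<Sum>a\<in>A. l a * ln (max (v a) e))"
        using mono order_trans by blast
    next
      assume "\<forall>e>0. ln \<bar>s\<bar> \<le> (\<Sum>a\<in>A. l a * ln (max (v a) e))"
      then have "ln \<bar>s\<bar> \<le> (\<Sum>a\<in>A. l a * ln (max (v a) e0))" using e0 by blast
      also have "\<dots> = S" using small[of e0] e0 True by simp
      finally show "ln \<bar>s\<bar> \<le> S" .
    qed
    ultimately show ?thesis using s by blast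
  next
    case False
    then have L: "0 < L" using L0 by simp
    then obtain a where a: "a \<in> Z" "l a \<noteq> 0" unfolding L_def by (metis sum.neutral less_irrefl)
    have "(\<Sum>a\<in>Z. ereal (l a) * (-\<infinity>)) = - \<infinity>"
    proof -
      have "(\<Sum>a\<in>Z. ereal (l a) * (-\<infinity>)) = (\<Sum>a\<in>Z. ereal (l a)) * (-\<infinity>)"
        using lZ by (subst sum_ereal_left_distrib) auto
      then show ?thesis using L by (simp add: L_def)
    qed
    then have "\<not> eln \<bar>s\<bar> \<le> (\<Sum>a\<in>A. ereal (l a) * eln (v a))"
      unfolding sum_ereal using s by (simp add: eln_def)
    moreover have "\<exists>e>0. (\<Sum>a\<in>A. l a * ln (max (v a) e)) < ln \<bar>s\<bar>"
    proof -
      define q where "q = (ln \<bar>s\<bar> - S) / L - 1"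
      define e where "e = min e0 (exp q)"
      have e: "0 < e" "e \<le> e0" using e0 by (auto simp: e_def)
      have "ln e \<le> ln (exp q)" using e(1) unfolding e_def by (subst ln_le_cancel_iff) auto
      then have "ln e \<le> q" by simp
      then have "L * ln e \<le> L * q" using L by simp
      also have "\<dots> = ln \<bar>s\<bar> - S - L" using L by (simp add: q_def field_simps)
      finally have "S + L * ln e < ln \<bar>s\<bar>" using L by simp
      then show ?thesis using small[OF e] e(1) by auto
    qed
    ultimately show ?thesis using s linorder_not_le by blast
  qed
qed

text \<open>
Truncating the left-hand side as well is harmless, because the weights sum to 1 and so \<open>ln e\<close> is at
most the truncated sum.  In this form the inequality involves a single real-valued function.
\<close>
lemma eln_le_iff_truncated_both:
  fixes v :: "'a::real_vector \<Rightarrow> real"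
  assumes fin: "finite A" and l: "weights A b l" and v: "\<And>a. a \<in> A \<Longrightarrow> 0 \<le> v a" and vb: "0 \<le> v b"
  shows "eln \<bar>v b\<bar> \<le> (\<Sum>a\<in>A. ereal (l a) * eln (v a)) \<longleftrightarrow>
    (\<forall>e>0. ln (max (v b) e) \<le> (\<Sum>a\<in>A. l a * ln (max (v a) e)))"
proof -
  have l': "\<And>a. a \<in> A \<Longrightarrow> 0 \<le> l a" "sum l A = 1" using l by (auto simp: weights_def)
  have low: "ln e \<le> (\<Sum>a\<in>A. l a * ln (max (v a) e))" if e: "0 < e" for e
  proof -
    have "ln e = (\<Sum>a\<in>A. l a * ln e)" using l'(2) by (simp flip: sum_distrib_right)
    also have "\<dots> \<le> (\<Sum>a\<in>A. l a * ln (max (v a) e))"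
      using e l'(1) by (intro sum_mono mult_left_mono) (auto simp: less_max_iff_disj)
    finally show ?thesis .
  qed
  have "(v b \<noteq> 0 \<longrightarrow> (\<forall>e>0. ln (v b) \<le> (\<Sum>a\<in>A. l a * ln (max (v a) e)))) \<longleftrightarrow>
    (\<forall>e>0. ln (max (v b) e) \<le> (\<Sum>a\<in>A. l a * ln (max (v a) e)))" (is "?L \<longleftrightarrow> ?R")
  proof
    assume ?L
    then show ?R using low vb by (auto simp: max_def)
  next
    assume R: ?R
    show ?L
    proof (intro impI allI)
      fix e :: real assume "v b \<noteq> 0" "0 < e"
      then have "ln (v b) \<le> ln (max (v b) e)" using vb by simp
      then show "ln (v b) \<le> (\<Sum>a\<in>A. l a * ln (max (v a) e))" using R \<open>0 < e\<close> by fastforce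
    qed
  qed
  then show ?thesis
    using eln_le_iff_truncated[where l = l and v = v and s = "v b", OF fin l'(1) v] vb by simp
qed

section \<open>Evaluation of AG functions\<close>

text \<open>
The value of \<open>|x|\<^sup>\<alpha>\<close> wherever it is finite.
\<close>
definition rmon :: "real^'n::finite \<Rightarrow> real^'n \<Rightarrow> real" where
  "rmon \<alpha> x = (\<Prod>j\<in>UNIV. if \<alpha> $ j = 0 then 1 else \<bar>x $ j\<bar> powr (\<alpha> $ j))"

lemma rmon_nonneg: "0 \<le> rmon \<alpha> x"
  unfolding rmon_def by (intro prod_nonneg) simp

lemma abs_monomial_finite:
  "abs_monomial \<alpha> x \<noteq> \<infinity> \<longleftrightarrow> (\<forall>j. x $ j = 0 \<longrightarrow> 0 \<le> \<alpha> $ j)"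
  "abs_monomial \<alpha> x \<noteq> \<infinity> \<Longrightarrow> abs_monomial \<alpha> x = ereal (rmon \<alpha> x)"
  unfolding abs_monomial_def rmon_def by (auto simp: not_less not_le split: if_splits)

lemma abs_of_monomial: "abs (monomial \<beta> x) = rmon (real_vec \<beta>) x"
  unfolding monomial_def rmon_def abs_prod
  by (intro prod.cong) (auto simp: real_vec_def power_abs powr_realpow' powr_def[of 0] power_0_left)

lemma rmon_exp:
  assumes "\<And>j. x $ j \<noteq> 0 \<or> \<alpha> $ j = 0" "\<And>j. x $ j \<noteq> 0 \<Longrightarrow> \<bar>x $ j\<bar> = exp (y $ j)"
  shows "rmon \<alpha> x = exp (\<alpha> \<bullet> y)"
proof -
  have "rmon \<alpha> x = (\<Prod>j\<in>UNIV. exp (\<alpha> $ j * y $ j))"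
    unfolding rmon_def using assms by (intro prod.cong) (auto simp: powr_def)
  then show ?thesis by (simp add: exp_sum inner_vec_def)
qed

lemma rmon_eq_0:
  assumes "x $ j = 0" "\<alpha> $ j \<noteq> 0"
  shows "rmon \<alpha> x = 0"
  unfolding rmon_def using assms by (intro prod_zero) (auto intro!: bexI[of _ j])

text \<open>
At a zero coordinate \<open>x\<^sub>j\<close> the exponents occurring on the right are non-negative.  If \<open>b\<^sub>j > 0\<close>, the
left-hand side vanishes.  If \<open>b\<^sub>j = 0\<close>, all those exponents vanish at \<open>j\<close>, so only non-zero coordinates
enter; there the monomials are exponentials and the claim is Jensen's inequality for \<open>exp\<close>.
\<close>
lemma amgm_monomial:
  assumes fin: "finite A" and l: "weights A b l" and c: "\<And>a. a \<in> A \<Longrightarrow> 0 < c a"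
    and bfin: "abs_monomial b x \<noteq> \<infinity>"
    and afin: "\<And>a. a \<in> A \<Longrightarrow> l a \<noteq> 0 \<Longrightarrow> abs_monomial a x \<noteq> \<infinity>"
  shows "exp (\<Sum>a\<in>A. l a * ln (c a)) * rmon b x \<le> (\<Sum>a\<in>A. l a * c a * rmon a x)"
proof (cases "\<exists>j. x $ j = 0 \<and> b $ j \<noteq> 0")
  case True
  then have "rmon b x = 0" using rmon_eq_0 by blast
  moreover have "0 \<le> (\<Sum>a\<in>A. l a * c a * rmon a x)"
    using l c by (intro sum_nonneg mult_nonneg_nonneg rmon_nonneg) (auto simp: weights_def less_imp_le)
  ultimately show ?thesis by simp
next
  case False
  have l': "\<And>a. a \<in> A \<Longrightarrow> 0 \<le> l a" "sum l A = 1" "(\<Sum>a\<in>A. l a *\<^sub>R a) = b"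
    using l by (auto simp: weights_def)
  define y :: "real^'a" where "y = (\<chi> j. ln \<bar>x $ j\<bar>)"
  have y: "\<bar>x $ j\<bar> = exp (y $ j)" if "x $ j \<noteq> 0" for j using that by (simp add: y_def)
  have a0: "a $ j = 0" if a: "a \<in> A" "l a \<noteq> 0" "x $ j = 0" for a j
  proof -
    have "(\<Sum>a\<in>A. l a * a $ j) = b $ j"
      using arg_cong[OF l'(3), of "\<lambda>z. z $ j"] by (simp add: sum_component)
    then have s0: "(\<Sum>a\<in>A. l a * a $ j) = 0" using False a(3) by auto
    have "0 \<le> l z * z $ j" if z: "z \<in> A" for z
    proof (cases "l z = 0")
      case False
      then have "0 \<le> z $ j" using afin[OF z] a(3) abs_monomial_finite(1)[of z x] by blast
      then show ?thesis using l'(1)[OF z] by simp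
    qed simp
    then have "l a * a $ j = 0" using sum_nonneg_eq_0_iff[OF fin, of "\<lambda>a. l a * a $ j"] s0 a(1) by blast
    then show ?thesis using a(2) by simp
  qed
  have ne: "A \<noteq> {}" using l'(2) by auto
  have "exp (\<Sum>a\<in>A. l a * ln (c a)) * rmon b x = exp (\<Sum>a\<in>A. l a *\<^sub>R (ln (c a) + a \<bullet> y))"
  proof -
    have "rmon b x = exp (b \<bullet> y)" using False y by (intro rmon_exp) auto
    moreover have "b \<bullet> y = (\<Sum>a\<in>A. l a * (a \<bullet> y))" by (simp add: inner_sum_left flip: l'(3))
    ultimately show ?thesis by (simp add: sum.distrib distrib_left exp_add)
  qed
  also have "\<dots> \<le> (\<Sum>a\<in>A. l a * exp (ln (c a) + a \<bullet> y))"
    by (rule convex_on_sum[OF fin ne exp_convex l'(2)]) (use l'(1) in auto)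
  also have "\<dots> = (\<Sum>a\<in>A. l a * c a * rmon a x)"
  proof (intro sum.cong refl)
    fix a assume a: "a \<in> A"
    show "l a * exp (ln (c a) + a \<bullet> y) = l a * c a * rmon a x"
    proof (cases "l a = 0")
      case False
      then have "rmon a x = exp (a \<bullet> y)" using a0[OF a] y by (intro rmon_exp) auto
      then show ?thesis using c[OF a] by (simp add: exp_add)
    qed simp
  qed
  finally show ?thesis .
qed

text \<open>
The sum may run over all of \<open>\<A>\<close>: \<open>rmon\<close> is real even where an exponent with coefficient zero would
give an infinite monomial.
\<close>
lemma ag_eval_real:
  fixes f :: "'n::finite ag_fun"
  assumes "finite \<A>" "Poly_Mapping.keys (fst f) \<subseteq> \<A>"
    and fin: "\<And>\<alpha>. \<alpha> \<in> Poly_Mapping.keys (fst f) \<Longrightarrow> abs_monomial \<alpha> x \<noteq> \<infinity>"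
  shows "ag_eval f x = ereal ((\<Sum>\<alpha>\<in>\<A>. Poly_Mapping.lookup (fst f) \<alpha> * rmon \<alpha> x)
    + (\<Sum>\<beta>\<in>Poly_Mapping.keys (snd f). Poly_Mapping.lookup (snd f) \<beta> * monomial \<beta> x))"
proof -
  have "(\<Sum>\<alpha>\<in>Poly_Mapping.keys (fst f). ereal (Poly_Mapping.lookup (fst f) \<alpha>) * abs_monomial \<alpha> x)
      = (\<Sum>\<alpha>\<in>Poly_Mapping.keys (fst f). ereal (Poly_Mapping.lookup (fst f) \<alpha> * rmon \<alpha> x))"
    using fin by (intro sum.cong refl) (simp add: abs_monomial_finite(2))
  also have "\<dots> = ereal (\<Sum>\<alpha>\<in>Poly_Mapping.keys (fst f). Poly_Mapping.lookup (fst f) \<alpha> * rmon \<alpha> x)"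
    by simp
  also have "(\<Sum>\<alpha>\<in>Poly_Mapping.keys (fst f). Poly_Mapping.lookup (fst f) \<alpha> * rmon \<alpha> x)
      = (\<Sum>\<alpha>\<in>\<A>. Poly_Mapping.lookup (fst f) \<alpha> * rmon \<alpha> x)"
    using assms(1,2) by (intro sum.mono_neutral_left) (auto simp: in_keys_iff)
  finally show ?thesis using fin by (auto simp: ag_eval_def)
qed

lemma nonneg_funI:
  fixes f :: "'n::finite ag_fun"
  assumes "finite \<A>" "Poly_Mapping.keys (fst f) \<subseteq> \<A>"
    and "\<And>x. (\<And>\<alpha>. \<alpha> \<in> Poly_Mapping.keys (fst f) \<Longrightarrow> abs_monomial \<alpha> x \<noteq> \<infinity>) \<Longrightarrow>
      0 \<le> (\<Sum>\<alpha>\<in>\<A>. Poly_Mapping.lookup (fst f) \<alpha> * rmon \<alpha> x)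
        + (\<Sum>\<beta>\<in>Poly_Mapping.keys (snd f). Poly_Mapping.lookup (snd f) \<beta> * monomial \<beta> x)"
  shows "nonneg_fun f"
  unfolding nonneg_fun_def
proof
  fix x
  show "0 \<le> ag_eval f x"
  proof (cases "\<exists>\<alpha>\<in>Poly_Mapping.keys (fst f). abs_monomial \<alpha> x = \<infinity>")
    case True
    then show ?thesis by (simp add: ag_eval_def)
  next
    case False
    then show ?thesis using ag_eval_real[OF assms(1,2), of x] assms(3)[of x] by auto
  qed
qed

lemma even_nonneg_coeffs:
  fixes p :: "(real^'n::finite) \<Rightarrow>\<^sub>0 real"
  assumes "\<And>\<alpha>. 0 \<le> Poly_Mapping.lookup p \<alpha>"
  shows "nonneg_fun (p, 0)"
  by (rule nonneg_funI[of "Poly_Mapping.keys p"])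
    (auto intro!: sum_nonneg mult_nonneg_nonneg rmon_nonneg assms)

definition coeff_map :: "'a set \<Rightarrow> ('a \<Rightarrow> real) \<Rightarrow> 'a \<Rightarrow>\<^sub>0 real" where
  "coeff_map A c = (\<Sum>a\<in>A. Poly_Mapping.single a (c a))"

lemma lookup_coeff_map:
  assumes "finite A"
  shows "Poly_Mapping.lookup (coeff_map A c) a = (if a \<in> A then c a else 0)"
  using assms by (simp add: coeff_map_def lookup_sum lookup_single when_def)

lemma keys_coeff_map:
  assumes "finite A"
  shows "Poly_Mapping.keys (coeff_map A c) = {a \<in> A. c a \<noteq> 0}"
  by (auto simp: in_keys_iff lookup_coeff_map[OF assms] split: if_splits)

text \<open>
The coefficient at \<open>b\<close> combines the contribution \<open>l b * c b\<close> with \<open>- g\<close>.  If the result is negative,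
\<open>b\<close> and all points of positive weight occur in the function, so at points where its value is finite
the arithmetic-geometric mean inequality applies.  Otherwise \<open>b\<close> may have dropped out and that
argument is not available, but then no coefficient is negative.
\<close>
lemma even_amgm_fun:
  fixes \<A> :: "(real^'n::finite) set"
  assumes fin: "finite \<A>" and b: "b \<in> \<A>" and l: "weights \<A> b l" and c: "\<And>a. a \<in> \<A> \<Longrightarrow> 0 < c a"
  defines "g \<equiv> exp (\<Sum>a\<in>\<A>. l a * ln (c a))"
  defines "C \<equiv> \<lambda>a. l a * c a - (if a = b then g else 0)"
  shows "(coeff_map \<A> C, 0) \<in> fun_space \<A> \<B>" "even_AG (coeff_map \<A> C, 0)"
    "nonneg_fun (coeff_map \<A> C, 0)"
proof -
  have lc: "0 \<le> l a * c a" if "a \<in> \<A>" for a using l c[OF that] that by (simp add: weights_def)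
  show "(coeff_map \<A> C, 0) \<in> fun_space \<A> \<B>"
    using fin by (auto simp: fun_space_def keys_coeff_map)
  have "{\<alpha>. Poly_Mapping.lookup (coeff_map \<A> C) \<alpha> < 0} \<subseteq> {b}"
    using lc by (force simp: lookup_coeff_map[OF fin] C_def simp flip: not_le split: if_splits)
  then have "card {\<alpha>. Poly_Mapping.lookup (coeff_map \<A> C) \<alpha> < 0} \<le> card {b}"
    by (intro card_mono) auto
  then show "even_AG (coeff_map \<A> C, 0)" by (simp add: even_AG_def)
  show "nonneg_fun (coeff_map \<A> C, 0)"
  proof (cases "C b < 0")
    case False
    then have "0 \<le> C a" if "a \<in> \<A>" for a using lc[OF that] that by (cases "a = b") (auto simp: C_def)
    then show ?thesis by (intro even_nonneg_coeffs) (simp add: lookup_coeff_map[OF fin])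
  next
    case True
    show ?thesis
    proof (rule nonneg_funI[OF fin])
      show "Poly_Mapping.keys (fst (coeff_map \<A> C, 0)) \<subseteq> \<A>"
        using fin by (auto simp: keys_coeff_map)
      fix x
      assume fin_x: "\<And>\<alpha>. \<alpha> \<in> Poly_Mapping.keys (fst (coeff_map \<A> C, 0)) \<Longrightarrow> abs_monomial \<alpha> x \<noteq> \<infinity>"
      have "g * rmon b x \<le> (\<Sum>a\<in>\<A>. l a * c a * rmon a x)"
        unfolding g_def
      proof (rule amgm_monomial[OF fin l c])
        show bx: "abs_monomial b x \<noteq> \<infinity>" using fin_x[of b] b True by (simp add: keys_coeff_map[OF fin])
        fix a assume a: "a \<in> \<A>" "l a \<noteq> 0"
        show "abs_monomial a x \<noteq> \<infinity>"
        proof (cases "a = b")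
          case False
          then have "C a \<noteq> 0" using a c[OF a(1)] by (simp add: C_def)
          then show ?thesis using fin_x[of a] a by (simp add: keys_coeff_map[OF fin])
        qed (use bx in simp)
      qed
      moreover have "(\<Sum>a\<in>\<A>. C a * rmon a x) = (\<Sum>a\<in>\<A>. l a * c a * rmon a x) - g * rmon b x"
        using fin b by (simp add: C_def left_diff_distrib sum_subtractf if_distrib[of "\<lambda>z. z * _"] cong: if_cong)
      ultimately show "0 \<le> (\<Sum>\<alpha>\<in>\<A>. Poly_Mapping.lookup (fst (coeff_map \<A> C, 0)) \<alpha> * rmon \<alpha> x) +
          (\<Sum>\<beta>\<in>Poly_Mapping.keys (snd (coeff_map \<A> C, 0)).
            Poly_Mapping.lookup (snd (coeff_map \<A> C, 0)) \<beta> * monomial \<beta> x)"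
        by (simp add: lookup_coeff_map[OF fin])
    qed
  qed
qed

lemma odd_amgm_fun:
  fixes \<A> :: "(real^'n::finite) set"
  assumes fin: "finite \<A>" and l: "weights \<A> (real_vec \<beta>) l"
    and c: "\<And>a. a \<in> \<A> \<Longrightarrow> 0 < c a"
    and d: "\<bar>d\<bar> = exp (\<Sum>a\<in>\<A>. l a * ln (c a))"
  defines "f \<equiv> (coeff_map \<A> (\<lambda>a. l a * c a), Poly_Mapping.single \<beta> d)"
  shows "\<beta> \<in> \<B> \<Longrightarrow> f \<in> fun_space \<A> \<B>" "odd_AG f" "nonneg_fun f"
proof -
  have lc: "0 \<le> l a * c a" if "a \<in> \<A>" for a using l c[OF that] that by (simp add: weights_def)
  have d0: "d \<noteq> 0" using d by auto
  show "f \<in> fun_space \<A> \<B>" if "\<beta> \<in> \<B>"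
    using fin that d0 by (auto simp: f_def fun_space_def keys_coeff_map)
  show "odd_AG f" using lc d0 by (simp add: f_def odd_AG_def lookup_coeff_map[OF fin])
  show "nonneg_fun f"
  proof (rule nonneg_funI[OF fin])
    show "Poly_Mapping.keys (fst f) \<subseteq> \<A>" using fin by (auto simp: f_def keys_coeff_map)
    fix x assume fin_x: "\<And>\<alpha>. \<alpha> \<in> Poly_Mapping.keys (fst f) \<Longrightarrow> abs_monomial \<alpha> x \<noteq> \<infinity>"
    have "\<bar>d * monomial \<beta> x\<bar> = exp (\<Sum>a\<in>\<A>. l a * ln (c a)) * rmon (real_vec \<beta>) x"
      by (simp add: abs_mult d abs_of_monomial)
    also have "\<dots> \<le> (\<Sum>a\<in>\<A>. l a * c a * rmon a x)"
    proof (rule amgm_monomial[OF fin l c])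
      show "abs_monomial (real_vec \<beta>) x \<noteq> \<infinity>"
        unfolding abs_monomial_finite(1) by (simp add: real_vec_def)
      fix a assume a: "a \<in> \<A>" "l a \<noteq> 0"
      then show "abs_monomial a x \<noteq> \<infinity>"
        using fin_x[of a] c[OF a(1)] by (simp add: f_def keys_coeff_map[OF fin])
    qed
    finally show "0 \<le> (\<Sum>\<alpha>\<in>\<A>. Poly_Mapping.lookup (fst f) \<alpha> * rmon \<alpha> x) +
        (\<Sum>\<beta>\<in>Poly_Mapping.keys (snd f). Poly_Mapping.lookup (snd f) \<beta> * monomial \<beta> x)"
      using d0 by (simp add: f_def lookup_coeff_map[OF fin])
  qed
qed

section \<open>The dual cone\<close>

text \<open>
The pairing is linear in \<open>f\<close>, so its non-negativity passes from the generators to the whole cone.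
\<close>
lemma dual_S_cone_iff:
  fixes \<A> :: "(real^'n::finite) set"
  assumes "v \<in> \<A> \<rightarrow>\<^sub>E UNIV" "w \<in> \<B> \<rightarrow>\<^sub>E UNIV"
  shows "(v, w) \<in> dual_S_cone \<A> \<B> \<longleftrightarrow>
    (\<forall>f \<in> fun_space \<A> \<B>. even_AG f \<or> odd_AG f \<longrightarrow> nonneg_fun f \<longrightarrow> 0 \<le> pairing \<A> \<B> (v, w) f)"
proof -
  define S where "S = {f \<in> fun_space \<A> \<B>. (even_AG f \<or> odd_AG f) \<and> nonneg_fun f}"
  have cone: "convex_cone {f. 0 \<le> pairing \<A> \<B> (v, w) f}"
  proof -
    have sc: "Poly_Mapping.lookup (c *\<^sub>R p) a = c * Poly_Mapping.lookup p a"
      for c and p :: "'z \<Rightarrow>\<^sub>0 real" and a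
    proof -
      have "finite {i. c * Poly_Mapping.lookup p i \<noteq> 0}"
        by (rule finite_subset[OF _ finite_lookup[of p]]) auto
      then show ?thesis by (simp add: scaleR_poly_mapping_def)
    qed
    have 1: "pairing \<A> \<B> (v, w) (f + g) = pairing \<A> \<B> (v, w) f + pairing \<A> \<B> (v, w) g" for f g
      by (cases f; cases g) (simp add: pairing_def lookup_add distrib_left sum.distrib)
    have 2: "pairing \<A> \<B> (v, w) (c *\<^sub>R f) = c * pairing \<A> \<B> (v, w) f" for c f
      by (cases f) (simp add: pairing_def sc distrib_left sum_distrib_left mult.left_commute)
    have 3: "pairing \<A> \<B> (v, w) 0 = 0" using 2[of 0 0] by simp
    show ?thesis unfolding convex_cone_iff by (auto simp: 1 2 3)
  qed
  have "(\<forall>f\<in>S_cone \<A> \<B>. 0 \<le> pairing \<A> \<B> (v, w) f) \<longleftrightarrow> (\<forall>f\<in>S. 0 \<le> pairing \<A> \<B> (v, w) f)"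
  proof
    assume "\<forall>f\<in>S. 0 \<le> pairing \<A> \<B> (v, w) f"
    then have "S_cone \<A> \<B> \<subseteq> {f. 0 \<le> pairing \<A> \<B> (v, w) f}"
      unfolding S_cone_def S_def[symmetric] by (intro hull_minimal cone) auto
    then show "\<forall>f\<in>S_cone \<A> \<B>. 0 \<le> pairing \<A> \<B> (v, w) f" by blast
  qed (auto simp: S_cone_def S_def intro: hull_inc)
  then show ?thesis using assms by (auto simp: dual_S_cone_def S_def)
qed

text \<open>
Away from the coordinate hyperplanes no monomial is infinite, so non-negativity becomes a
real inequality between exponentials.
\<close>
lemma nonneg_fun_exp:
  fixes f :: "'n::finite ag_fun"
  assumes fin: "finite \<A>" and f: "f \<in> fun_space \<A> \<B>" "nonneg_fun f"
    and x: "\<And>j. \<bar>x $ j\<bar> = exp (y $ j)"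
  shows "0 \<le> (\<Sum>\<alpha>\<in>\<A>. Poly_Mapping.lookup (fst f) \<alpha> * exp (\<alpha> \<bullet> y))
        + (\<Sum>\<beta>\<in>Poly_Mapping.keys (snd f). Poly_Mapping.lookup (snd f) \<beta> * monomial \<beta> x)"
proof -
  have x0: "x $ j \<noteq> 0" for j using x[of j] by auto
  have r: "rmon \<alpha> x = exp (\<alpha> \<bullet> y)" for \<alpha> using x x0 by (intro rmon_exp) auto
  have "abs_monomial \<alpha> x \<noteq> \<infinity>" for \<alpha> unfolding abs_monomial_finite(1) using x0 by simp
  then have "ag_eval f x = ereal ((\<Sum>\<alpha>\<in>\<A>. Poly_Mapping.lookup (fst f) \<alpha> * rmon \<alpha> x)
        + (\<Sum>\<beta>\<in>Poly_Mapping.keys (snd f). Poly_Mapping.lookup (snd f) \<beta> * monomial \<beta> x))"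
    using f(1) by (intro ag_eval_real fin) (auto simp: fun_space_def)
  moreover have "0 \<le> ag_eval f x" using f(2) by (simp add: nonneg_fun_def)
  ultimately show ?thesis by (simp add: r)
qed

text \<open>
An exponent with an odd entry \<open>i\<close> changes sign with the coordinate \<open>x\<^sub>i\<close>, so the term \<open>d x\<^sup>\<beta>\<close> can be
made negative at a point with prescribed absolute values.
\<close>
lemma sign_point:
  fixes \<beta> :: "nat^'n::finite"
  assumes odd: "odd (\<beta> $ i)" and d: "(d::real) \<noteq> 0"
  obtains x where "\<And>j. \<bar>x $ j\<bar> = exp (y $ j)" "d * monomial \<beta> x = - \<bar>d\<bar> * exp (real_vec \<beta> \<bullet> y)"
proof -
  define x :: "real \<Rightarrow> real^'n" where "x s = (\<chi> j. (if j = i then s else 1) * exp (y $ j))" for s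
  have mon: "monomial \<beta> (x s) = s ^ (\<beta> $ i) * exp (real_vec \<beta> \<bullet> y)" for s
  proof -
    have "monomial \<beta> (x s) = (\<Prod>j\<in>UNIV. (if j = i then s ^ (\<beta> $ i) else 1) * exp (real (\<beta> $ j) * y $ j))"
      unfolding monomial_def x_def
      by (intro prod.cong) (auto simp: power_mult_distrib exp_of_nat_mult)
    also have "\<dots> = s ^ (\<beta> $ i) * exp (real_vec \<beta> \<bullet> y)"
      by (simp add: prod.distrib exp_sum inner_vec_def real_vec_def)
    finally show ?thesis .
  qed
  show ?thesis
  proof (rule that[of "x (- sgn d)"])
    show "\<bar>x (- sgn d) $ j\<bar> = exp (y $ j)" for j
      using d by (simp add: x_def abs_mult abs_sgn_eq)
    show "d * monomial \<beta> (x (- sgn d)) = - \<bar>d\<bar> * exp (real_vec \<beta> \<bullet> y)"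
      unfolding mon using d odd by (cases "d > 0") (auto simp: sgn_if)
  qed
qed

lemma dual_S_cone_pairing_nonneg:
  fixes \<A> :: "(real^'n::finite) set"
  assumes "v \<in> \<A> \<rightarrow>\<^sub>E UNIV" "w \<in> \<B> \<rightarrow>\<^sub>E UNIV" "(v, w) \<in> dual_S_cone \<A> \<B>"
    and "f \<in> fun_space \<A> \<B>" "even_AG f \<or> odd_AG f" "nonneg_fun f"
  shows "0 \<le> pairing \<A> \<B> (v, w) f"
  using assms(3-6) dual_S_cone_iff[OF assms(1,2)] by blast

text \<open>
The monomial \<open>|x|\<^sup>\<alpha>\<close> is itself a non-negative even AG function, and its pairing is \<open>v\<^sub>\<alpha>\<close>.
\<close>
lemma dual_S_cone_imp_nonneg:
  fixes \<A> :: "(real^'n::finite) set"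
  assumes fin: "finite \<A>" and "v \<in> \<A> \<rightarrow>\<^sub>E UNIV" "w \<in> \<B> \<rightarrow>\<^sub>E UNIV"
    and dual: "(v, w) \<in> dual_S_cone \<A> \<B>" and \<alpha>: "\<alpha> \<in> \<A>"
  shows "0 \<le> v \<alpha>"
proof -
  define f :: "'n ag_fun" where "f = (Poly_Mapping.single \<alpha> 1, 0)"
  have lk: "Poly_Mapping.lookup (Poly_Mapping.single \<alpha> (1::real)) \<gamma> = (if \<gamma> = \<alpha> then 1 else 0)" for \<gamma>
    by (simp add: lookup_single when_def)
  have "f \<in> fun_space \<A> \<B>" using \<alpha> by (simp add: f_def fun_space_def)
  moreover have "even_AG f" by (simp add: f_def even_AG_def lk)
  moreover have "nonneg_fun f" unfolding f_def by (intro even_nonneg_coeffs) (simp add: lk)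
  ultimately have "0 \<le> pairing \<A> \<B> (v, w) f" using dual_S_cone_pairing_nonneg[OF assms(2,3) dual] by blast
  then show ?thesis
    using \<alpha> fin by (simp add: f_def pairing_def lk if_distrib[of "\<lambda>z. _ * z"] cong: if_cong)
qed

text \<open>
The conclusion drawn from pairing with the function of \<open>even_amgm_fun\<close> or \<open>odd_amgm_fun\<close> for the
choice \<open>c\<^sub>a = 1 / max v\<^sub>a e\<close>: the positive part of the pairing is then at most \<open>\<Sum> l\<^sub>a = 1\<close>.
\<close>
lemma ln_le_of_reciprocal_pairing:
  fixes l v :: "'a::real_vector \<Rightarrow> real"
  assumes l: "weights A b l" and e: "0 < e"
    and le: "exp (\<Sum>a\<in>A. l a * ln (1 / max (v a) e)) * t \<le> (\<Sum>a\<in>A. v a * (l a * (1 / max (v a) e)))"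
    and t: "0 < t"
  shows "ln t \<le> (\<Sum>a\<in>A. l a * ln (max (v a) e))"
proof -
  define S where "S = (\<Sum>a\<in>A. l a * ln (max (v a) e))"
  have l': "\<And>a. a \<in> A \<Longrightarrow> 0 \<le> l a" "sum l A = 1" using l by (auto simp: weights_def)
  have m: "0 < max (v a) e" for a using e by (simp add: less_max_iff_disj)
  have "ln (1 / x) = - ln x" if "0 < x" for x :: real using that by (simp add: ln_div)
  then have "(\<Sum>a\<in>A. l a * ln (1 / max (v a) e)) = - S"
    using m by (simp only: S_def mult_minus_right sum_negf)
  then have "exp (- S) * t \<le> (\<Sum>a\<in>A. v a * (l a * (1 / max (v a) e)))" using le by simp
  also have "\<dots> \<le> (\<Sum>a\<in>A. l a)"
  proof (intro sum_mono)
    fix a assume a: "a \<in> A"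
    have "v a / max (v a) e \<le> 1" using m[of a] by (simp add: divide_le_eq_1)
    then have "l a * (v a / max (v a) e) \<le> l a * 1" using l'(1)[OF a] by (rule mult_left_mono)
    then show "v a * (l a * (1 / max (v a) e)) \<le> l a" by (simp only: mult_1_right times_divide_eq_right mult.commute[of "v a"])
  qed
  finally have "exp (- S) * t \<le> 1" using l'(2) by simp
  then have "exp S * (exp (- S) * t) \<le> exp S * 1" by (intro mult_left_mono) auto
  then have "t \<le> exp S" by (simp flip: mult.assoc exp_add)
  then have "ln t \<le> ln (exp S)" using t by (subst ln_le_cancel_iff) auto
  then show ?thesis by (simp add: S_def)
qed

lemma dual_imp_truncated_even:
  fixes \<A> :: "(real^'n::finite) set"
  assumes fin: "finite \<A>" and ext: "v \<in> \<A> \<rightarrow>\<^sub>E UNIV" "w \<in> \<B> \<rightarrow>\<^sub>E UNIV"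
    and v: "\<And>a. a \<in> \<A> \<Longrightarrow> 0 \<le> v a" and dual: "(v, w) \<in> dual_S_cone \<A> \<B>"
    and b: "b \<in> \<A>" "v b \<noteq> 0" and l: "weights \<A> b l" and e: "0 < e"
  shows "ln (v b) \<le> (\<Sum>a\<in>\<A>. l a * ln (max (v a) e))"
proof (rule ln_le_of_reciprocal_pairing[OF l e])
  define c where "c a = 1 / max (v a) e" for a
  define g where "g = exp (\<Sum>a\<in>\<A>. l a * ln (c a))"
  define C where "C = (\<lambda>a. l a * c a - (if a = b then g else 0))"
  have c: "0 < c a" for a using e by (simp add: c_def less_max_iff_disj)
  have "0 \<le> pairing \<A> \<B> (v, w) (coeff_map \<A> C, 0)"
    unfolding C_def g_def
    by (intro dual_S_cone_pairing_nonneg[OF ext dual] disjI1 even_amgm_fun fin b(1) l c)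
  also have "\<dots> = (\<Sum>a\<in>\<A>. v a * (l a * c a) - (if a = b then g * v b else 0))"
    unfolding pairing_def by (simp add: lookup_coeff_map[OF fin]) (auto intro!: sum.cong simp: C_def algebra_simps)
  also have "\<dots> = (\<Sum>a\<in>\<A>. v a * (l a * c a)) - g * v b"
    using fin b(1) by (simp add: sum_subtractf)
  finally have "g * v b \<le> (\<Sum>a\<in>\<A>. v a * (l a * c a))" by simp
  then show "exp (\<Sum>a\<in>\<A>. l a * ln (1 / max (v a) e)) * v b
      \<le> (\<Sum>a\<in>\<A>. v a * (l a * (1 / max (v a) e)))"
    by (simp add: g_def c_def)
  show "0 < v b" using v[OF b(1)] b(2) by simp
qed

lemma dual_imp_truncated_odd:
  fixes \<A> :: "(real^'n::finite) set"
  assumes fin: "finite \<A>" "finite \<B>" and ext: "v \<in> \<A> \<rightarrow>\<^sub>E UNIV" "w \<in> \<B> \<rightarrow>\<^sub>E UNIV"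
    and v: "\<And>a. a \<in> \<A> \<Longrightarrow> 0 \<le> v a" and dual: "(v, w) \<in> dual_S_cone \<A> \<B>"
    and \<beta>: "\<beta> \<in> \<B>" "w \<beta> \<noteq> 0" and l: "weights \<A> (real_vec \<beta>) l" and e: "0 < e"
  shows "ln \<bar>w \<beta>\<bar> \<le> (\<Sum>a\<in>\<A>. l a * ln (max (v a) e))"
proof (rule ln_le_of_reciprocal_pairing[OF l e])
  define c where "c a = 1 / max (v a) e" for a
  define g where "g = exp (\<Sum>a\<in>\<A>. l a * ln (c a))"
  define d where "d = - sgn (w \<beta>) * g"
  have c: "0 < c a" for a using e by (simp add: c_def less_max_iff_disj)
  have d: "\<bar>d\<bar> = exp (\<Sum>a\<in>\<A>. l a * ln (c a))"
    using \<beta>(2) by (simp add: d_def abs_mult abs_sgn_eq g_def)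
  have "0 \<le> pairing \<A> \<B> (v, w) (coeff_map \<A> (\<lambda>a. l a * c a), Poly_Mapping.single \<beta> d)"
    by (intro dual_S_cone_pairing_nonneg[OF ext dual] disjI2 odd_amgm_fun fin \<beta>(1) l c d)
  also have "\<dots> = (\<Sum>a\<in>\<A>. v a * (l a * c a)) + w \<beta> * d"
    using fin \<beta>(1) by (simp add: pairing_def lookup_coeff_map lookup_single when_def
        if_distrib[of "\<lambda>z. _ * z"] cong: if_cong)
  also have "w \<beta> * d = - (g * \<bar>w \<beta>\<bar>)" by (cases "0 < w \<beta>") (simp_all add: d_def sgn_if)
  finally show "exp (\<Sum>a\<in>\<A>. l a * ln (1 / max (v a) e)) * \<bar>w \<beta>\<bar>
      \<le> (\<Sum>a\<in>\<A>. v a * (l a * (1 / max (v a) e)))"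
    by (simp add: g_def c_def)
  show "0 < \<bar>w \<beta>\<bar>" using \<beta>(2) by simp
qed

text \<open>
It is enough to test an AG function that has one negative term, since a function with non-negative
coefficients pairs non-negatively with \<open>v \<ge> 0\<close>.  An odd term is made negative by the choice
of signs in \<open>sign_point\<close>.  Moving the negative term to the other side leaves the signomial inequality treated in \<open>nonneg_signomial_imp_pairing\<close>.
\<close>
lemma truncated_imp_dual:
  fixes \<A> :: "(real^'n::finite) set"
  assumes fin: "finite \<A>" "finite \<B>" and odd: "\<B> \<inter> {\<beta>. \<forall>j. even (\<beta> $ j)} = {}"
    and ext: "v \<in> \<A> \<rightarrow>\<^sub>E UNIV" "w \<in> \<B> \<rightarrow>\<^sub>E UNIV"
    and v: "\<And>a. a \<in> \<A> \<Longrightarrow> 0 \<le> v a"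
    and even_le: "\<And>b l e. b \<in> \<A> \<Longrightarrow> weights \<A> b l \<Longrightarrow> 0 < e \<Longrightarrow>
      ln (max (v b) e) \<le> (\<Sum>a\<in>\<A>. l a * ln (max (v a) e))"
    and odd_le: "\<And>\<beta> l e. \<beta> \<in> \<B> \<Longrightarrow> w \<beta> \<noteq> 0 \<Longrightarrow> weights \<A> (real_vec \<beta>) l \<Longrightarrow> 0 < e \<Longrightarrow>
      ln \<bar>w \<beta>\<bar> \<le> (\<Sum>a\<in>\<A>. l a * ln (max (v a) e))"
  shows "(v, w) \<in> dual_S_cone \<A> \<B>"
  unfolding dual_S_cone_iff[OF ext]
proof (intro ballI impI)
  fix f assume f: "f \<in> fun_space \<A> \<B>" "nonneg_fun f" and AG: "even_AG f \<or> odd_AG f"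
  obtain p q where pq: "f = (p, q)" by (cases f)
  define C where "C = Poly_Mapping.lookup p"
  have bound: "D * t \<le> (\<Sum>a\<in>\<A>. c a * v a)"
    if t: "0 \<le> t" "\<And>e l. 0 < e \<Longrightarrow> t \<noteq> 0 \<Longrightarrow> weights \<A> b l \<Longrightarrow> ln t \<le> (\<Sum>a\<in>\<A>. l a * ln (max (v a) e))"
      and c: "\<And>a. a \<in> \<A> \<Longrightarrow> 0 \<le> c a" and D: "0 \<le> D"
      and nonneg: "\<And>y. D * exp (b \<bullet> y) \<le> (\<Sum>a\<in>\<A>. c a * exp (a \<bullet> y))" for D t b c
  proof (cases "t = 0")
    case True
    then show ?thesis using c v by (simp add: sum_nonneg)
  next
    case False
    show ?thesis
    proof (rule le_sum_truncation_limit[OF c v])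
      fix e :: real assume e: "0 < e"
      show "D * t \<le> (\<Sum>a\<in>\<A>. c a * max (v a) e)"
      proof (rule nonneg_signomial_imp_pairing[OF fin(1) _ _ _ c D nonneg])
        show "0 < max (v a) e" for a using e by (simp add: less_max_iff_disj)
        show "0 < t" using t(1) False by simp
        show "ln t \<le> (\<Sum>a\<in>\<A>. l a * ln (max (v a) e))" if "weights \<A> b l" for l
          by (rule t(2)[OF e False that])
      qed
    qed
  qed
  have truncated_le: "ln (v b) \<le> (\<Sum>a\<in>\<A>. l a * ln (max (v a) e))"
    if "b \<in> \<A>" "0 < e" "v b \<noteq> 0" "weights \<A> b l" for b e l
  proof -
    have "ln (v b) \<le> ln (max (v b) e)" using v[OF that(1)] that(3) by simp
    then show ?thesis using even_le[OF that(1,4,2)] by linarith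
  qed
  show "0 \<le> pairing \<A> \<B> (v, w) f"
  proof (cases "q = 0")
    case True
    have pair: "pairing \<A> \<B> (v, w) f = (\<Sum>a\<in>\<A>. C a * v a)"
      by (simp add: pq True pairing_def C_def mult.commute)
    show ?thesis
    proof (cases "\<exists>b\<in>\<A>. C b < 0")
      case False
      then show ?thesis unfolding pair using v by (intro sum_nonneg mult_nonneg_nonneg) (auto simp: not_less)
    next
      case True
      then obtain b where b: "b \<in> \<A>" "C b < 0" by blast
      have card: "card {a. C a < 0} \<le> 1"
        using AG \<open>C b < 0\<close> by (auto simp: even_AG_def odd_AG_def pq C_def not_le[symmetric])
      have finN: "finite {a. C a < 0}"
        by (rule finite_subset[OF _ finite_lookup[of p]]) (auto simp: C_def)
      have unique: "0 \<le> C a" if "a \<noteq> b" for a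
      proof (rule ccontr)
        assume "\<not> 0 \<le> C a"
        then have "{a, b} \<subseteq> {a. C a < 0}" using b(2) by auto
        then have "card {a, b} \<le> 1" using card card_mono[OF finN] order_trans by blast
        then show False using that by simp
      qed
      define c where "c a = (if a = b then 0 else C a)" for a
      have split: "(\<Sum>a\<in>\<A>. C a * u a) = (\<Sum>a\<in>\<A>. c a * u a) - (- C b) * u b" for u
      proof -
        have "(\<Sum>a\<in>\<A>. C a * u a) = (\<Sum>a\<in>\<A>. c a * u a - (if a = b then - C b * u b else 0))"
          by (intro sum.cong) (auto simp: c_def)
        also have "\<dots> = (\<Sum>a\<in>\<A>. c a * u a) - (- C b) * u b"
          using fin(1) b(1) by (simp add: sum_subtractf)
        finally show ?thesis .
      qed
      have "- C b * v b \<le> (\<Sum>a\<in>\<A>. c a * v a)"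
      proof (rule bound)
        show "- C b * exp (b \<bullet> y) \<le> (\<Sum>a\<in>\<A>. c a * exp (a \<bullet> y))" for y
          using nonneg_fun_exp[OF fin(1) f, of "\<chi> j. exp (y $ j)" y] split[of "\<lambda>a. exp (a \<bullet> y)"]
          by (simp add: pq \<open>q = 0\<close> C_def)
        show "0 \<le> v b" using v b(1) by blast
        show "ln (v b) \<le> (\<Sum>a\<in>\<A>. l a * ln (max (v a) e))"
          if "0 < e" "v b \<noteq> 0" "weights \<A> b l" for e l
          using truncated_le[OF b(1) that] .
        show "0 \<le> c a" for a using unique by (simp add: c_def)
        show "0 \<le> - C b" using b(2) by simp
      qed
      then show ?thesis unfolding pair split[of v] by simp
    qed
  next
    case False
    then have nn: "0 \<le> C a" for a using AG by (auto simp: even_AG_def odd_AG_def pq C_def)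
    have "card (Poly_Mapping.keys q) \<le> 1" using AG False by (auto simp: even_AG_def odd_AG_def pq)
    moreover have "Poly_Mapping.keys q \<noteq> {}" using False by simp
    ultimately have "card (Poly_Mapping.keys q) = 1" by (simp add: le_Suc_eq)
    then obtain \<beta> where keys: "Poly_Mapping.keys q = {\<beta>}" by (rule card_1_singletonE)
    then have \<beta>: "\<beta> \<in> \<B>" using f(1) by (simp add: fun_space_def pq)
    define d where "d = Poly_Mapping.lookup q \<beta>"
    have d: "d \<noteq> 0" using keys by (auto simp: d_def simp flip: in_keys_iff)
    have "(\<Sum>\<gamma>\<in>\<B>. w \<gamma> * Poly_Mapping.lookup q \<gamma>) = (\<Sum>\<gamma>\<in>{\<beta>}. w \<gamma> * Poly_Mapping.lookup q \<gamma>)"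
      using fin(2) \<beta> keys by (intro sum.mono_neutral_right) (auto simp: in_keys_iff set_eq_iff)
    then have pair: "pairing \<A> \<B> (v, w) f = (\<Sum>a\<in>\<A>. C a * v a) + w \<beta> * d"
      by (simp add: pq pairing_def C_def d_def mult.commute)
    obtain i where i: "odd (\<beta> $ i)" using odd \<beta> by blast
    have "\<bar>d\<bar> * \<bar>w \<beta>\<bar> \<le> (\<Sum>a\<in>\<A>. C a * v a)"
    proof (rule bound)
      show "\<bar>d\<bar> * exp (real_vec \<beta> \<bullet> y) \<le> (\<Sum>a\<in>\<A>. C a * exp (a \<bullet> y))" for y
      proof -
        obtain x where x: "\<And>j. \<bar>x $ j\<bar> = exp (y $ j)"
            "d * monomial \<beta> x = - \<bar>d\<bar> * exp (real_vec \<beta> \<bullet> y)"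
          using sign_point[OF i d] by blast
        show ?thesis
          using nonneg_fun_exp[OF fin(1) f x(1)] x(2) by (simp add: pq keys C_def d_def)
      qed
      show "ln \<bar>w \<beta>\<bar> \<le> (\<Sum>a\<in>\<A>. l a * ln (max (v a) e))"
        if "0 < e" "\<bar>w \<beta>\<bar> \<noteq> 0" "weights \<A> (real_vec \<beta>) l" for e l
        using odd_le[OF \<beta> _ that(3,1)] that(2) by simp
    qed (use nn in auto)
    moreover have "- (\<bar>d\<bar> * \<bar>w \<beta>\<bar>) \<le> w \<beta> * d"
      using abs_ge_minus_self[of "w \<beta> * d"] by (simp add: abs_mult mult.commute)
    ultimately show ?thesis unfolding pair by linarith
  qed
qed

section \<open>Equivalence of the four conditions\<close>

lemma Lam_weights: "l \<in> Lam A b \<Longrightarrow> weights A b l"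
  by (auto simp: Lam_def weights_def)

lemma weights_restrict_Lam: "weights A b l \<Longrightarrow> restrict l A \<in> Lam A b"
  by (auto simp: Lam_def weights_def)

lemma circuit_lam_weights:
  assumes "circuit A b"
  shows "weights A b (circuit_lam A b)"
  unfolding circuit_lam_def by (rule Lam_weights[OF theI'[OF circuit_lam_unique[OF assms]]])

lemma circuit_lam_eq:
  assumes "circuit A b" "weights A b m"
  shows "(\<Sum>a\<in>A. m a * q a) = (\<Sum>a\<in>A. circuit_lam A b a * q a)"
proof (intro sum.cong refl)
  fix a assume "a \<in> A"
  then have "m a = circuit_lam A b a"
    using assms weights_unique circuit_lam_weights unfolding circuit_def by metis
  then show "m a * q a = circuit_lam A b a * q a" by simp
qed

theorem theorem3p5:
  fixes \<A> :: "(real^'n::finite) set"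
    and \<B> :: "(nat^'n) set"
    and v :: "real^'n \<Rightarrow> real"
    and w :: "nat^'n \<Rightarrow> real"
  assumes "finite \<A>" and "\<A> \<noteq> {}"
    and "finite \<B>" and "\<B> \<inter> {\<beta>. \<forall>j. even (\<beta> $ j)} = {}"
    and "v \<in> \<A> \<rightarrow>\<^sub>E UNIV" and "w \<in> \<B> \<rightarrow>\<^sub>E UNIV"
  shows
    "((v, w) \<in> dual_S_cone \<A> \<B> \<longrightarrow> (\<forall>\<alpha>\<in>\<A>. 0 \<le> v \<alpha>))
     \<and>
     ((\<forall>\<alpha>\<in>\<A>. 0 \<le> v \<alpha>) \<longrightarrow>
       (let
          a = (v, w) \<in> dual_S_cone \<A> \<B>;
          b = (\<forall>\<beta>\<in>\<A>. \<forall>l\<in>Lam \<A> \<beta>.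
                 eln \<bar>v \<beta>\<bar> \<le> (\<Sum>\<alpha>\<in>\<A>. ereal (l \<alpha>) * eln (v \<alpha>)))
            \<and> (\<forall>\<beta>\<in>\<B>. \<forall>l\<in>Lam \<A> (real_vec \<beta>).
                 eln \<bar>w \<beta>\<bar> \<le> (\<Sum>\<alpha>\<in>\<A>. ereal (l \<alpha>) * eln (v \<alpha>)));
          c = (\<forall>(A, \<beta>)\<in>even_circuits \<A>.
                 eln \<bar>v \<beta>\<bar> \<le> (\<Sum>\<alpha>\<in>A. ereal (circuit_lam A \<beta> \<alpha>) * eln (v \<alpha>)))
            \<and> (\<forall>(A, \<beta>)\<in>odd_circuits \<A> \<B>.
                 eln \<bar>w \<beta>\<bar> \<le> (\<Sum>\<alpha>\<in>A. ereal (circuit_lam A (real_vec \<beta>) \<alpha>) * eln (v \<alpha>)));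
          d = (\<forall>(A, \<beta>)\<in>reduced_even_circuits \<A>.
                 eln \<bar>v \<beta>\<bar> \<le> (\<Sum>\<alpha>\<in>A. ereal (circuit_lam A \<beta> \<alpha>) * eln (v \<alpha>)))
            \<and> (\<forall>(A, \<beta>)\<in>reduced_odd_circuits \<A> \<B>.
                 eln \<bar>w \<beta>\<bar> \<le> (\<Sum>\<alpha>\<in>A. ereal (circuit_lam A (real_vec \<beta>) \<alpha>) * eln (v \<alpha>)))
        in (a \<longleftrightarrow> b) \<and> (b \<longleftrightarrow> c) \<and> (c \<longleftrightarrow> d)))"
  (is "?one \<and> (?nonneg \<longrightarrow> ?equiv)")
proof (intro conjI impI)
  show "\<forall>\<alpha>\<in>\<A>. 0 \<le> v \<alpha>" if "(v, w) \<in> dual_S_cone \<A> \<B>"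
    using dual_S_cone_imp_nonneg[OF assms(1,5,6) that] by blast
next
  assume nonneg: ?nonneg
  then have v: "\<And>\<alpha>. \<alpha> \<in> \<A> \<Longrightarrow> 0 \<le> v \<alpha>" by blast
  define Ev where "Ev A b l \<longleftrightarrow> eln \<bar>v b\<bar> \<le> (\<Sum>\<alpha>\<in>A. ereal (l \<alpha>) * eln (v \<alpha>))" for A b l
  define Od where "Od A \<beta> l \<longleftrightarrow> eln \<bar>w \<beta>\<bar> \<le> (\<Sum>\<alpha>\<in>A. ereal (l \<alpha>) * eln (v \<alpha>))" for A \<beta> l
  have finA: "finite A" if "A \<subseteq> \<A>" for A using that assms(1) finite_subset by blast
  have Ev_iff: "Ev A b l \<longleftrightarrow> (\<forall>e>0. ln (max (v b) e) \<le> (\<Sum>\<alpha>\<in>A. l \<alpha> * ln (max (v \<alpha>) e)))"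
    if "A \<subseteq> \<A>" "b \<in> \<A>" "weights A b l" for A b l
    unfolding Ev_def using that v by (intro eln_le_iff_truncated_both finA) auto
  have Od_iff: "Od A \<beta> l \<longleftrightarrow> (w \<beta> \<noteq> 0 \<longrightarrow> (\<forall>e>0. ln \<bar>w \<beta>\<bar> \<le> (\<Sum>\<alpha>\<in>A. l \<alpha> * ln (max (v \<alpha>) e))))"
    if "A \<subseteq> \<A>" "weights A b l" for A \<beta> b l
    unfolding Od_def using that v by (intro eln_le_iff_truncated finA) (auto simp: weights_def)
  define a where "a \<longleftrightarrow> (v, w) \<in> dual_S_cone \<A> \<B>"
  define b where "b \<longleftrightarrow> (\<forall>\<beta>\<in>\<A>. \<forall>l\<in>Lam \<A> \<beta>. Ev \<A> \<beta> l) \<and> (\<forall>\<beta>\<in>\<B>. \<forall>l\<in>Lam \<A> (real_vec \<beta>). Od \<A> \<beta> l)"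
  define c where "c \<longleftrightarrow> (\<forall>(A, \<beta>)\<in>even_circuits \<A>. Ev A \<beta> (circuit_lam A \<beta>))
      \<and> (\<forall>(A, \<beta>)\<in>odd_circuits \<A> \<B>. Od A \<beta> (circuit_lam A (real_vec \<beta>)))"
  define d where "d \<longleftrightarrow> (\<forall>(A, \<beta>)\<in>reduced_even_circuits \<A>. Ev A \<beta> (circuit_lam A \<beta>))
      \<and> (\<forall>(A, \<beta>)\<in>reduced_odd_circuits \<A> \<B>. Od A \<beta> (circuit_lam A (real_vec \<beta>)))"
  \<comment> \<open>The truncated form of (b), through which the implications pass.\<close>
  define T where "T \<longleftrightarrow> (\<forall>e>0.
      (\<forall>\<beta>\<in>\<A>. \<forall>l. weights \<A> \<beta> l \<longrightarrow> ln (max (v \<beta>) e) \<le> (\<Sum>\<alpha>\<in>\<A>. l \<alpha> * ln (max (v \<alpha>) e))) \<and>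
      (\<forall>\<beta>\<in>\<B>. \<forall>l. w \<beta> \<noteq> 0 \<longrightarrow> weights \<A> (real_vec \<beta>) l \<longrightarrow>
        ln \<bar>w \<beta>\<bar> \<le> (\<Sum>\<alpha>\<in>\<A>. l \<alpha> * ln (max (v \<alpha>) e))))"
  have Tb: b if T: T
    unfolding b_def
  proof (intro conjI ballI)
    fix \<beta> l assume *: "\<beta> \<in> \<A>" "l \<in> Lam \<A> \<beta>"
    then show "Ev \<A> \<beta> l" using T Ev_iff[OF order_refl *(1) Lam_weights[OF *(2)]] Lam_weights[OF *(2)]
      by (auto simp: T_def)
  next
    fix \<beta> l assume *: "\<beta> \<in> \<B>" "l \<in> Lam \<A> (real_vec \<beta>)"
    then show "Od \<A> \<beta> l" using T Od_iff[OF order_refl Lam_weights[OF *(2)]] Lam_weights[OF *(2)]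
      by (auto simp: T_def)
  qed
  have ab: b if a: a
    unfolding b_def
  proof (intro conjI ballI)
    fix \<beta> l assume *: "\<beta> \<in> \<A>" "l \<in> Lam \<A> \<beta>"
    note l = Lam_weights[OF *(2)]
    have "eln \<bar>v \<beta>\<bar> \<le> (\<Sum>\<alpha>\<in>\<A>. ereal (l \<alpha>) * eln (v \<alpha>)) \<longleftrightarrow>
      (v \<beta> \<noteq> 0 \<longrightarrow> (\<forall>e>0. ln \<bar>v \<beta>\<bar> \<le> (\<Sum>a\<in>\<A>. l a * ln (max (v a) e))))"
      using l v by (intro eln_le_iff_truncated assms(1)) (auto simp: weights_def)
    then show "Ev \<A> \<beta> l"
      using dual_imp_truncated_even[OF assms(1,5,6) v a[unfolded a_def] *(1) _ l] v[OF *(1)]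
      by (simp add: Ev_def)
  next
    fix \<beta> l assume *: "\<beta> \<in> \<B>" "l \<in> Lam \<A> (real_vec \<beta>)"
    note l = Lam_weights[OF *(2)]
    show "Od \<A> \<beta> l"
      using dual_imp_truncated_odd[OF assms(1,3,5,6) v a[unfolded a_def] *(1) _ l] Od_iff[OF order_refl l]
      by simp
  qed
  have bT: T if b: b
    unfolding T_def
  proof (intro allI impI conjI ballI)
    fix e :: real and \<beta> l assume e: "0 < e" and *: "\<beta> \<in> \<A>" "weights \<A> \<beta> l"
    have "Ev \<A> \<beta> (restrict l \<A>)"
      using b[unfolded b_def] *(1) weights_restrict_Lam[OF *(2)] by blast
    then have "Ev \<A> \<beta> l" by (simp add: Ev_def)
    then show "ln (max (v \<beta>) e) \<le> (\<Sum>\<alpha>\<in>\<A>. l \<alpha> * ln (max (v \<alpha>) e))"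
      using Ev_iff[OF order_refl *] e by blast
  next
    fix e :: real and \<beta> l assume e: "0 < e" and *: "\<beta> \<in> \<B>" "w \<beta> \<noteq> 0" "weights \<A> (real_vec \<beta>) l"
    have "Od \<A> \<beta> (restrict l \<A>)"
      using b[unfolded b_def] *(1) weights_restrict_Lam[OF *(3)] by blast
    then have "Od \<A> \<beta> l" by (simp add: Od_def)
    then show "ln \<bar>w \<beta>\<bar> \<le> (\<Sum>\<alpha>\<in>\<A>. l \<alpha> * ln (max (v \<alpha>) e))"
      using Od_iff[OF order_refl *(3)] *(2) e by blast
  qed
  have Ta: a if T: T
    unfolding a_def using T by (intro truncated_imp_dual assms v) (auto simp: T_def)
  have Tc: c if T: T
    unfolding c_def
  proof (intro conjI ballI; clarify)
    fix A \<beta> assume "(A, \<beta>) \<in> even_circuits \<A>"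
    then have *: "A \<subseteq> \<A>" "\<beta> \<in> \<A>" "circuit A \<beta>" by (auto simp: even_circuits_def)
    note m = circuit_lam_weights[OF *(3)]
    show "Ev A \<beta> (circuit_lam A \<beta>)"
      unfolding Ev_iff[OF *(1,2) m]
    proof (intro allI impI)
      fix e :: real assume "0 < e"
      then show "ln (max (v \<beta>) e) \<le> (\<Sum>\<alpha>\<in>A. circuit_lam A \<beta> \<alpha> * ln (max (v \<alpha>) e))"
        using T *(2) weights_extend(1)[OF assms(1) *(1) m]
        unfolding T_def weights_extend(2)[OF assms(1) *(1) m, symmetric] by blast
    qed
  next
    fix A \<beta> assume "(A, \<beta>) \<in> odd_circuits \<A> \<B>"
    then have *: "A \<subseteq> \<A>" "\<beta> \<in> \<B>" "circuit A (real_vec \<beta>)" by (auto simp: odd_circuits_def)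
    note m = circuit_lam_weights[OF *(3)]
    show "Od A \<beta> (circuit_lam A (real_vec \<beta>))"
      unfolding Od_iff[OF *(1) m]
    proof (intro allI impI)
      fix e :: real assume "w \<beta> \<noteq> 0" "0 < e"
      then show "ln \<bar>w \<beta>\<bar> \<le> (\<Sum>\<alpha>\<in>A. circuit_lam A (real_vec \<beta>) \<alpha> * ln (max (v \<alpha>) e))"
        using T *(2) weights_extend(1)[OF assms(1) *(1) m]
        unfolding T_def weights_extend(2)[OF assms(1) *(1) m, symmetric] by blast
    qed
  qed
  have cd: d if c using that by (auto simp: c_def d_def reduced_even_circuits_def reduced_odd_circuits_def)
  have dT: T if d: d
    unfolding T_def
  proof (intro allI impI)
    fix e :: real assume e: "0 < e"
    define h where "h \<alpha> = ln (max (v \<alpha>) e)" for \<alpha>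
    have even: "h \<beta> \<le> (\<Sum>\<alpha>\<in>\<A>. l \<alpha> * h \<alpha>)" if "\<beta> \<in> \<A>" "weights \<A> \<beta> l" for \<beta> l
    proof (rule reduced_even_imp_convex[OF assms(1) _ that])
      fix A b m assume *: "A \<subseteq> \<A>" "b \<in> \<A>" "circuit A b"
        "(convex hull A - (A \<union> {b})) \<inter> \<A> = {}" "weights A b m"
      then have "(A, b) \<in> reduced_even_circuits \<A>"
        by (simp add: reduced_even_circuits_def even_circuits_def)
      then have "Ev A b (circuit_lam A b)" using d by (auto simp: d_def)
      then show "h b \<le> (\<Sum>a\<in>A. m a * h a)"
        using Ev_iff[OF *(1,2) circuit_lam_weights[OF *(3)]] e
        by (simp add: circuit_lam_eq[OF *(3,5)] h_def)
    qed
    moreover have "ln \<bar>w \<beta>\<bar> \<le> (\<Sum>\<alpha>\<in>\<A>. l \<alpha> * h \<alpha>)"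
      if "\<beta> \<in> \<B>" "w \<beta> \<noteq> 0" "weights \<A> (real_vec \<beta>) l" for \<beta> l
    proof (rule reduced_odd_imp_below[OF assms(1) even _ that(3)])
      fix A m assume *: "A \<subseteq> \<A>" "circuit A (real_vec \<beta>)"
        "(convex hull A - A) \<inter> \<A> = {}" "weights A (real_vec \<beta>) m"
      then have "(A, \<beta>) \<in> reduced_odd_circuits \<A> \<B>"
        using that by (simp add: reduced_odd_circuits_def odd_circuits_def)
      then have "Od A \<beta> (circuit_lam A (real_vec \<beta>))" using d by (auto simp: d_def)
      then show "ln \<bar>w \<beta>\<bar> \<le> (\<Sum>a\<in>A. m a * h a)"
        using Od_iff[OF *(1) circuit_lam_weights[OF *(2)]] e that(2)
        by (simp add: circuit_lam_eq[OF *(2,4)] h_def)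
    qed
    ultimately show "(\<forall>\<beta>\<in>\<A>. \<forall>l. weights \<A> \<beta> l \<longrightarrow> ln (max (v \<beta>) e) \<le> (\<Sum>\<alpha>\<in>\<A>. l \<alpha> * ln (max (v \<alpha>) e))) \<and>
      (\<forall>\<beta>\<in>\<B>. \<forall>l. w \<beta> \<noteq> 0 \<longrightarrow> weights \<A> (real_vec \<beta>) l \<longrightarrow>
        ln \<bar>w \<beta>\<bar> \<le> (\<Sum>\<alpha>\<in>\<A>. l \<alpha> * ln (max (v \<alpha>) e)))"
      by (auto simp: h_def)
  qed
  have "(a \<longleftrightarrow> b) \<and> (b \<longleftrightarrow> c) \<and> (c \<longleftrightarrow> d)"
    using ab bT Tb Ta Tc cd dT by blast
  then show ?equiv
    unfolding Let_def a_def b_def c_def d_def Ev_def Od_def .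
qed

end
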